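(* Let $\beta\in\mathbb C$ with $\beta^4=-1$, let $Q=\overline{U}_{\mathrm i}s\ell(2)$ and let $\Phi\in Q^{\otimes 3}$ be the coassociator given in the context (depending on $\beta^2$). Then $\Phi$ defines a non-trivial cohomology class in the third (non-abelian) Hopf algebra cohomology of $Q$. In particular, the quasi-Hopf algebra $(Q,\Phi)$ cannot be obtained as a Drinfeld twist of the Hopf algebra $Q$: there is no invertible $\mathcal F\in Q\otimes Q$ with $(\epsilon\otimes\mathrm{id})(\mathcal F)=1=(\mathrm{id}\otimes\epsilon)(\mathcal F)$, with $\mathcal F\Delta(a)=\Delta(a)\mathcal F$ for all $a\in Q$, and with $$\Phi=(\mathcal F\otimes1)\cdot(\Delta\otimes\mathrm{id})(\mathcal F)\cdot(\mathrm{id}\otimes\Delta)(\mathcal F^{-1})\cdot(1\otimes\mathcal F^{-1}).$$ Equivalently, the identity functor on the category of finite-dimensional $Q$-modules cannot be endowed with a monoidal structure making it a monoidal functor from $\mathbf{Rep}(Q,\Phi)$ (associator given by the action of $\Phi$) to $\mathbf{Rep}\,Q$ (trivial associator).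
   Context: $Q=\overline{U}_{\mathrm i}s\ell(2)$ is the associative unital $\mathbb C$-algebra with generators $E,F,K^{\pm1}$ and relations $KEK^{-1}=-E$, $KFK^{-1}=-F$, $[E,F]=\frac{K-K^{-1}}{2\mathrm i}$, $E^2=F^2=0$, $K^4=1$ (dimension 16). It is a Hopf algebra with $\Delta(E)=1\otimes E+E\otimes K$, $\Delta(F)=K^{-1}\otimes F+F\otimes 1$, $\Delta(K)=K\otimes K$, $\epsilon(E)=\epsilon(F)=0$, $\epsilon(K)=1$, $S(E)=-EK^{-1}$, $S(F)=-KF$, $S(K)=K^{-1}$. Central idempotents: $e_0=\frac12(1+K^2)$, $e_1=\frac12(1-K^2)$. The coassociator is $$\Phi=e_0\otimes e_0\otimes e_0+e_1\otimes e_0\otimes e_0+\Phi^{010}\,e_0\otimes e_1\otimes e_0+e_0\otimes e_0\otimes e_1+e_1\otimes e_1\otimes e_0+\Phi^{101}\,e_1\otimes e_0\otimes e_1+e_0\otimes e_1\otimes e_1+\Phi^{111}\,e_1\otimes e_1\otimes e_1,$$ with $\Phi^{010}=1\otimes1\otimes1-(1+\mathrm i)E\otimes K\otimes F+(1-\mathrm i)FK\otimes K\otimes EK+2\,EFK\otimes1\otimes EFK$; $\Phi^{101}=(\mathrm i-1)1\otimes F\otimes EK+1\otimes K\otimes1+2\cdot1\otimes EF\otimes EFK-(1+\mathrm i)1\otimes EK\otimes F-(1+\mathrm i)E\otimes FK\otimes1+2\mathrm i\,E\otimes EFK\otimes F+(1-\mathrm i)FK\otimes E\otimes1-2\mathrm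 i\,FK\otimes EFK\otimes EK-2\,EFK\otimes EF\otimes1$; $\Phi^{111}=\mathrm i\beta^2\{(1+\mathrm i)1\otimes F\otimes EK-1\otimes K\otimes1-2\cdot1\otimes EF\otimes1-2\mathrm i\,1\otimes EF\otimes EFK+(1+\mathrm i)1\otimes EK\otimes F-(1+\mathrm i)E\otimes1\otimes F+(1+\mathrm i)E\otimes FK\otimes1+2\mathrm i\,E\otimes FK\otimes EFK+2\,E\otimes EFK\otimes F-(1+\mathrm i)FK\otimes1\otimes EK+(1+\mathrm i)FK\otimes E\otimes1+2\mathrm i\,FK\otimes E\otimes EFK+2\,FK\otimes EFK\otimes EK+2\mathrm i\,EFK\otimes F\otimes EK+2\mathrm i\,EFK\otimes K\otimes EFK-2\mathrm i\,EFK\otimes EF\otimes1+2\mathrm i\,EFK\otimes EK\otimes F+4\,EFK\otimes EF\otimes EFK\}$. With this $\Phi$ (and coproduct $\Delta$), $Q$ is a quasi-bialgebra: $\Phi$ is invertible, $(\Delta\otimes\mathrm{id})\Delta(a)=\Phi\,(\mathrm{id}\otimes\Delta)\Delta(a)\,\Phi^{-1}$, $(\mathrm{id}\otimes\epsilon\otimes\mathrm{id})(\Phi)=1\otimes1$, and the 3-cocycle condition $(\Delta\otimes\mathrm{id}\otimes\mathrm{id})(\Phi)(\mathrm{id}\otimes\mathrm{id}\otimes\Delta)(\Phi)=(\Phi\otimes1)(\mathrm{id}\otimes\Delta\otimes\mathrm{id})(\Phi)(1\otimes\Phi)$ holds. The associator of $\mathbf{Rep}(Q,\Phi)$ is $U\otimes(V\otimes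 W)\to(U\otimes V)\otimes W$, $u\otimes v\otimes w\mapsto\Phi.(u\otimes v\otimes w)$. Here "non-trivial class" is understood as: $\Phi$ is not related to $1\otimes1\otimes1$ by a Drinfeld twist preserving the coproduct of $Q$, as displayed in the claim. *)

theory Defs
  imports Complex_Main "HOL-Library.Poly_Mapping" "Jordan_Normal_Form.Matrix"
begin

section \<open>Complex algebras\<close>

text \<open>Associative unital complex algebras. The axiom \<open>0 \<noteq> 1\<close> is left out, so that quotients and
  tensor products are instances without a proof that they are non-zero.\<close>

class complex_algebra = ring + monoid_mult +
  fixes scaleC :: "complex \<Rightarrow> 'a \<Rightarrow> 'a"  (infixr "*\<^sub>C" 66)
  assumes scaleC_add_right: "c *\<^sub>C (x + y) = c *\<^sub>C x + c *\<^sub>C y"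
    and scaleC_add_left: "(c + d) *\<^sub>C x = c *\<^sub>C x + d *\<^sub>C x"
    and scaleC_scaleC: "c *\<^sub>C d *\<^sub>C x = (c * d) *\<^sub>C x"
    and scaleC_one: "1 *\<^sub>C x = x"
    and mult_scaleC_left: "(c *\<^sub>C x) * y = c *\<^sub>C (x * y)"
    and mult_scaleC_right: "x * (c *\<^sub>C y) = c *\<^sub>C (x * y)"
begin

lemma scaleC_zero_right: "c *\<^sub>C 0 = 0"
  using scaleC_add_right[of c 0 0] by simp

lemma scaleC_zero_left: "0 *\<^sub>C x = 0"
  using scaleC_add_left[of 0 0 x] by simp

lemma scaleC_minus_left: "(- c) *\<^sub>C x = - (c *\<^sub>C x)"
  using scaleC_add_left[of c "- c" x] by (simp add: scaleC_zero_left eq_neg_iff_add_eq_0 add.commute)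

lemma scaleC_minus_right: "c *\<^sub>C (- x) = - (c *\<^sub>C x)"
  using scaleC_add_right[of c x "- x"] by (simp add: scaleC_zero_right eq_neg_iff_add_eq_0 add.commute)

lemma scaleC_sum_right: "c *\<^sub>C (\<Sum>i\<in>S. f i) = (\<Sum>i\<in>S. c *\<^sub>C f i)"
  by (induction S rule: infinite_finite_induct) (simp_all add: scaleC_zero_right scaleC_add_right)

end

instantiation complex :: complex_algebra
begin
definition scaleC_complex :: "complex \<Rightarrow> complex \<Rightarrow> complex"
  where "scaleC_complex = (*)"
instance by intro_classes (auto simp: scaleC_complex_def algebra_simps)
end

definition linear_C :: "('a::complex_algebra \<Rightarrow> 'b::complex_algebra) \<Rightarrow> bool"
  where "linear_C f \<longleftrightarrow> (\<forall>x y. f (x + y) = f x + f y) \<and> (\<forall>c x. f (c *\<^sub>C x) = c *\<^sub>C f x)"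

definition bilinear_C :: "('a::complex_algebra \<Rightarrow> 'b::complex_algebra \<Rightarrow> 'c::complex_algebra) \<Rightarrow> bool"
  where "bilinear_C h \<longleftrightarrow> (\<forall>b. linear_C (\<lambda>a. h a b)) \<and> (\<forall>a. linear_C (h a))"


section \<open>Formal linear combinations\<close>

text \<open>\<open>'k \<Rightarrow>\<^sub>0 complex\<close> is the free complex vector space on \<open>'k\<close>. If \<open>'k\<close> is a monoid, written
  additively, its multiplication is the one of the monoid algebra; in particular multiplication by
  \<open>Poly_Mapping.single 0 c\<close> is multiplication by the scalar \<open>c\<close>.\<close>

definition lin_ext :: "('k \<Rightarrow> 'v) \<Rightarrow> ('k \<Rightarrow>\<^sub>0 complex) \<Rightarrow> 'v::complex_algebra"
  where "lin_ext h x = (\<Sum>k\<in>Poly_Mapping.keys x. Poly_Mapping.lookup x k *\<^sub>C h k)"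

lemma lin_ext_superset:
  assumes "finite S" "Poly_Mapping.keys x \<subseteq> S"
  shows "lin_ext h x = (\<Sum>k\<in>S. Poly_Mapping.lookup x k *\<^sub>C h k)"
  unfolding lin_ext_def
  by (rule sum.mono_neutral_left)
    (use assms in \<open>auto simp: scaleC_zero_left in_keys_iff\<close>)

lemma lin_ext_zero [simp]: "lin_ext h 0 = 0"
  by (simp add: lin_ext_def)

lemma lin_ext_single [simp]: "lin_ext h (Poly_Mapping.single k c) = c *\<^sub>C h k"
  by (subst lin_ext_superset[of "{k}"]) auto

lemma lin_ext_add: "lin_ext h (x + y) = lin_ext h x + lin_ext h y"
proof -
  let ?S = "Poly_Mapping.keys x \<union> Poly_Mapping.keys y"
  have "lin_ext h (x + y) = (\<Sum>k\<in>?S. Poly_Mapping.lookup (x + y) k *\<^sub>C h k)"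
    by (rule lin_ext_superset) (use Poly_Mapping.keys_add[of x y] in auto)
  also have "\<dots> = lin_ext h x + lin_ext h y"
    by (subst (1 2) lin_ext_superset[of ?S])
      (auto simp: lookup_add scaleC_add_left sum.distrib)
  finally show ?thesis .
qed

lemma lin_ext_uminus: "lin_ext h (- x) = - lin_ext h x"
  using lin_ext_add[of h x "- x"] by (simp add: eq_neg_iff_add_eq_0 add.commute)

lemma lin_ext_diff: "lin_ext h (x - y) = lin_ext h x - lin_ext h y"
  using lin_ext_add[of h x "- y"] by (simp add: lin_ext_uminus)

lemma formal_induct [case_names zero single add]:
  fixes x :: "'k \<Rightarrow>\<^sub>0 complex"
  assumes "P 0" "\<And>k c. P (Poly_Mapping.single k c)" "\<And>x y. P x \<Longrightarrow> P y \<Longrightarrow> P (x + y)"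
  shows "P x"
proof (induction x rule: update_induct)
  case const show ?case by (rule assms(1))
next
  case (update f a b)
  have "Poly_Mapping.update a b f = f + Poly_Mapping.single a b"
    using update(1)
    by (intro poly_mapping_eqI) (auto simp: lookup_add lookup_update lookup_single when_def in_keys_iff)
  then show ?case using update assms(2,3) by simp
qed

lemma lin_ext_mult:
  fixes h :: "'k::monoid_add \<Rightarrow> 'v::complex_algebra"
  assumes "\<And>k l. h (k + l) = h k * h l"
  shows "lin_ext h (x * y) = lin_ext h x * lin_ext h y"
proof (induction x rule: formal_induct)
  case (single k c)
  show ?case
    by (induction y rule: formal_induct)
      (simp_all add: mult_single assms distrib_left lin_ext_add mult_scaleC_left
        mult_scaleC_right scaleC_scaleC mult.commute[of c])
qed (simp_all add: distrib_right lin_ext_add)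

lemma lin_ext_scale:
  fixes h :: "'k::monoid_add \<Rightarrow> 'v::complex_algebra"
  shows "lin_ext h (Poly_Mapping.single 0 c * x) = c *\<^sub>C lin_ext h x"
  by (induction x rule: formal_induct)
    (simp_all add: mult_single distrib_left lin_ext_add scaleC_zero_right scaleC_scaleC
      scaleC_add_right)

lemma single_zero_commute:
  fixes x :: "'k::monoid_add \<Rightarrow>\<^sub>0 complex"
  shows "x * Poly_Mapping.single 0 c = Poly_Mapping.single 0 c * x"
  by (induction x rule: formal_induct) (simp_all add: mult_single distrib_left distrib_right mult.commute)


section \<open>Tensor products of complex algebras\<close>

datatype ('a, 'b) pair_monoid = Pair_Monoid 'a 'b

instantiation pair_monoid :: (monoid_mult, monoid_mult) monoid_add
begin
definition zero_pair_monoid :: "('a, 'b) pair_monoid"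
  where "zero_pair_monoid = Pair_Monoid 1 1"
fun plus_pair_monoid :: "('a, 'b) pair_monoid \<Rightarrow> ('a, 'b) pair_monoid \<Rightarrow> ('a, 'b) pair_monoid"
  where "plus_pair_monoid (Pair_Monoid a b) (Pair_Monoid c d) = Pair_Monoid (a * c) (b * d)"
instance
proof
  fix x y z :: "('a, 'b) pair_monoid"
  show "x + y + z = x + (y + z)" by (cases x; cases y; cases z) (simp add: mult.assoc)
  show "0 + x = x" "x + 0 = x" by (cases x; simp add: zero_pair_monoid_def)+
qed
end

type_synonym ('a, 'b) formal_tensor = "('a, 'b) pair_monoid \<Rightarrow>\<^sub>0 complex"

abbreviation formal_pure :: "'a \<Rightarrow> 'b \<Rightarrow> complex \<Rightarrow> ('a, 'b) formal_tensor"
  where "formal_pure a b c \<equiv> Poly_Mapping.single (Pair_Monoid a b) c"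

inductive_set bilinearity_relations ::
    "('a::complex_algebra, 'b::complex_algebra) formal_tensor set" where
  zero: "0 \<in> bilinearity_relations"
| add: "x \<in> bilinearity_relations \<Longrightarrow> y \<in> bilinearity_relations \<Longrightarrow> x + y \<in> bilinearity_relations"
| scale: "x \<in> bilinearity_relations \<Longrightarrow> Poly_Mapping.single 0 c * x \<in> bilinearity_relations"
| add_left: "formal_pure (a + a') b 1 - formal_pure a b 1 - formal_pure a' b 1 \<in> bilinearity_relations"
| add_right: "formal_pure a (b + b') 1 - formal_pure a b 1 - formal_pure a b' 1 \<in> bilinearity_relations"
| scale_left: "formal_pure (c *\<^sub>C a) b 1 - formal_pure a b c \<in> bilinearity_relations"
| scale_right: "formal_pure a (c *\<^sub>C b) 1 - formal_pure a b c \<in> bilinearity_relations"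

lemma bilinearity_relations_uminus:
  assumes "x \<in> bilinearity_relations" shows "- x \<in> bilinearity_relations"
proof -
  have "Poly_Mapping.single 0 (- 1) * x = - x"
    by (simp add: single_uminus)
  then show ?thesis using bilinearity_relations.scale[OF assms, of "- 1"] by simp
qed

lemma bilinearity_relations_mult_left:
  fixes x :: "('a::complex_algebra, 'b::complex_algebra) formal_tensor"
  assumes "x \<in> bilinearity_relations"
  shows "y * x \<in> bilinearity_relations"
proof (induction y rule: formal_induct)
  case zero then show ?case by (simp add: bilinearity_relations.zero)
next
  case (add y z) then show ?case by (simp add: distrib_right bilinearity_relations.add)
next
  case (single k c)
  obtain p q where k: "k = Pair_Monoid p q" by (cases k)
  have sc: "Poly_Mapping.single k c = Poly_Mapping.single 0 c * formal_pure p q 1"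
    by (simp add: mult_single k)
  have "formal_pure p q 1 * x \<in> bilinearity_relations"
    using assms
  proof induction
    case zero then show ?case by (simp add: bilinearity_relations.zero)
  next
    case (add x y) then show ?case by (simp add: distrib_left bilinearity_relations.add)
  next
    case (scale x c)
    have "formal_pure p q 1 * (Poly_Mapping.single 0 c * x) = Poly_Mapping.single 0 c * (formal_pure p q 1 * x)"
      by (metis mult.assoc single_zero_commute)
    then show ?case using bilinearity_relations.scale[OF scale.IH] by simp
  next
    case (add_left a a' b)
    show ?case
      using bilinearity_relations.add_left[of "p * a" "p * a'" "q * b"]
      by (simp add: right_diff_distrib mult_single distrib_left)
  next
    case (add_right a b b')
    show ?case
      using bilinearity_relations.add_right[of "p * a" "q * b" "q * b'"]
      by (simp add: right_diff_distrib mult_single distrib_left)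
  next
    case (scale_left c a b)
    show ?case
      using bilinearity_relations.scale_left[of c "p * a" "q * b"]
      by (simp add: right_diff_distrib mult_single mult_scaleC_right)
  next
    case (scale_right a c b)
    show ?case
      using bilinearity_relations.scale_right[of "p * a" c "q * b"]
      by (simp add: right_diff_distrib mult_single mult_scaleC_right)
  qed
  then show ?case unfolding sc mult.assoc by (rule bilinearity_relations.scale)
qed

lemma bilinearity_relations_mult_right:
  fixes x :: "('a::complex_algebra, 'b::complex_algebra) formal_tensor"
  assumes "x \<in> bilinearity_relations"
  shows "x * y \<in> bilinearity_relations"
proof (induction y rule: formal_induct)
  case zero then show ?case by (simp add: bilinearity_relations.zero)
next
  case (add y z) then show ?case by (simp add: distrib_left bilinearity_relations.add)
next
  case (single k c)
  obtain p q where k: "k = Pair_Monoid p q" by (cases k)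
  have sc: "x * Poly_Mapping.single k c = Poly_Mapping.single 0 c * (x * formal_pure p q 1)"
    by (metis (no_types) k mult.assoc mult_1 mult_single add.right_neutral mult.right_neutral
        single_zero_commute add_0)
  have "x * formal_pure p q 1 \<in> bilinearity_relations"
    using assms
  proof induction
    case zero then show ?case by (simp add: bilinearity_relations.zero)
  next
    case (add x y) then show ?case by (simp add: distrib_right bilinearity_relations.add)
  next
    case (scale x c)
    then show ?case unfolding mult.assoc by (intro bilinearity_relations.scale)
  next
    case (add_left a a' b)
    show ?case
      using bilinearity_relations.add_left[of "a * p" "a' * p" "b * q"]
      by (simp add: left_diff_distrib mult_single distrib_right)
  next
    case (add_right a b b')
    show ?case
      using bilinearity_relations.add_right[of "a * p" "b * q" "b' * q"]
      by (simp add: left_diff_distrib mult_single distrib_right)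
  next
    case (scale_left c a b)
    show ?case
      using bilinearity_relations.scale_left[of c "a * p" "b * q"]
      by (simp add: left_diff_distrib mult_single mult_scaleC_left)
  next
    case (scale_right a c b)
    show ?case
      using bilinearity_relations.scale_right[of "a * p" c "b * q"]
      by (simp add: left_diff_distrib mult_single mult_scaleC_left)
  qed
  then show ?case unfolding sc by (rule bilinearity_relations.scale)
qed

definition tensor_eq ::
    "('a::complex_algebra, 'b::complex_algebra) formal_tensor \<Rightarrow> ('a, 'b) formal_tensor \<Rightarrow> bool"
  where "tensor_eq x y \<longleftrightarrow> x - y \<in> bilinearity_relations"

lemma equivp_tensor_eq: "equivp tensor_eq"
proof (rule equivpI)
  show "reflp tensor_eq"
    by (auto simp: reflp_def tensor_eq_def bilinearity_relations.zero)
  show "symp tensor_eq"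
    unfolding symp_def tensor_eq_def
    using bilinearity_relations_uminus by fastforce
  show "transp tensor_eq"
    unfolding transp_def tensor_eq_def
    using bilinearity_relations.add by fastforce
qed

quotient_type (overloaded) ('a, 'b) tensor =
    "('a::complex_algebra, 'b::complex_algebra) formal_tensor" / tensor_eq
  by (rule equivp_tensor_eq)

instantiation tensor :: (complex_algebra, complex_algebra) complex_algebra
begin

lift_definition zero_tensor :: "('a, 'b) tensor" is 0 .

lift_definition one_tensor :: "('a, 'b) tensor" is 1 .

lift_definition plus_tensor :: "('a, 'b) tensor \<Rightarrow> ('a, 'b) tensor \<Rightarrow> ('a, 'b) tensor" is "(+)"
  unfolding tensor_eq_def using bilinearity_relations.add by (fastforce simp: algebra_simps)

lift_definition uminus_tensor :: "('a, 'b) tensor \<Rightarrow> ('a, 'b) tensor" is uminus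
  unfolding tensor_eq_def using bilinearity_relations_uminus by fastforce

lift_definition minus_tensor :: "('a, 'b) tensor \<Rightarrow> ('a, 'b) tensor \<Rightarrow> ('a, 'b) tensor" is "(-)"
proof -
  fix x x' y y' :: "('a, 'b) formal_tensor"
  assume "tensor_eq x x'" "tensor_eq y y'"
  then have "(x - x') + - (y - y') \<in> bilinearity_relations"
    unfolding tensor_eq_def by (intro bilinearity_relations.add bilinearity_relations_uminus)
  then show "tensor_eq (x - y) (x' - y')"
    by (simp add: tensor_eq_def algebra_simps)
qed

lift_definition times_tensor :: "('a, 'b) tensor \<Rightarrow> ('a, 'b) tensor \<Rightarrow> ('a, 'b) tensor" is "(*)"
proof -
  fix x x' y y' :: "('a, 'b) formal_tensor"
  assume "tensor_eq x x'" "tensor_eq y y'"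
  then have "(x - x') * y + x' * (y - y') \<in> bilinearity_relations"
    unfolding tensor_eq_def
    by (intro bilinearity_relations.add bilinearity_relations_mult_left bilinearity_relations_mult_right)
  then show "tensor_eq (x * y) (x' * y')"
    by (simp add: tensor_eq_def algebra_simps)
qed

lift_definition scaleC_tensor :: "complex \<Rightarrow> ('a, 'b) tensor \<Rightarrow> ('a, 'b) tensor"
  is "\<lambda>c x. Poly_Mapping.single 0 c * x"
  unfolding tensor_eq_def by (simp flip: right_diff_distrib add: bilinearity_relations.scale)

instance
proof
  fix x y z :: "('a, 'b) tensor" and c d :: complex
  show "x + y + z = x + (y + z)" by transfer (simp add: tensor_eq_def bilinearity_relations.zero add.assoc)
  show "x + y = y + x" by transfer (simp add: tensor_eq_def bilinearity_relations.zero add.commute)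
  show "0 + x = x" by transfer (simp add: tensor_eq_def bilinearity_relations.zero)
  show "- x + x = 0" by transfer (simp add: tensor_eq_def bilinearity_relations.zero)
  show "x - y = x + - y" by transfer (simp add: tensor_eq_def bilinearity_relations.zero)
  show "x * y * z = x * (y * z)" by transfer (simp add: tensor_eq_def bilinearity_relations.zero mult.assoc)
  show "1 * x = x" "x * 1 = x" by (transfer, simp add: tensor_eq_def bilinearity_relations.zero)+
  show "(x + y) * z = x * z + y * z"
    by transfer (simp add: tensor_eq_def bilinearity_relations.zero distrib_right)
  show "x * (y + z) = x * y + x * z"
    by transfer (simp add: tensor_eq_def bilinearity_relations.zero distrib_left)
  show "c *\<^sub>C (x + y) = c *\<^sub>C x + c *\<^sub>C y"
    by transfer (simp add: tensor_eq_def bilinearity_relations.zero distrib_left)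
  show "(c + d) *\<^sub>C x = c *\<^sub>C x + d *\<^sub>C x"
    by transfer (simp add: tensor_eq_def bilinearity_relations.zero single_add distrib_right)
  show "c *\<^sub>C d *\<^sub>C x = (c * d) *\<^sub>C x"
    by transfer (simp add: tensor_eq_def bilinearity_relations.zero mult_single flip: mult.assoc)
  show "1 *\<^sub>C x = x"
    by transfer (simp add: tensor_eq_def bilinearity_relations.zero)
  show "(c *\<^sub>C x) * y = c *\<^sub>C (x * y)"
    by transfer (simp add: tensor_eq_def bilinearity_relations.zero mult.assoc)
  show "x * (c *\<^sub>C y) = c *\<^sub>C (x * y)"
    by transfer (metis cancel_comm_monoid_add_class.diff_cancel tensor_eq_def
        bilinearity_relations.zero mult.assoc single_zero_commute)
qed

end

lift_definition pure_tensor :: "'a::complex_algebra \<Rightarrow> 'b::complex_algebra \<Rightarrow> ('a, 'b) tensor"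
    (infixl "\<otimes>\<^sub>C" 68)
  is "\<lambda>a b. formal_pure a b 1" .

lemma pure_tensor_mult: "(a \<otimes>\<^sub>C b) * (c \<otimes>\<^sub>C d) = (a * c) \<otimes>\<^sub>C (b * d)"
  by transfer (simp add: mult_single tensor_eq_def bilinearity_relations.zero)

lemma one_tensor: "1 = 1 \<otimes>\<^sub>C 1"
  by transfer (simp add: tensor_eq_def bilinearity_relations.zero flip: zero_pair_monoid_def)

lemma bilinear_pure_tensor: "bilinear_C (\<otimes>\<^sub>C)"
  unfolding bilinear_C_def linear_C_def
proof (intro conjI allI; transfer)
  fix a a' :: 'a and b b' :: 'b and c :: complex
  show "tensor_eq (formal_pure (a + a') b 1) (formal_pure a b 1 + formal_pure a' b 1)"
    using bilinearity_relations.add_left by (simp add: tensor_eq_def algebra_simps)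
  show "tensor_eq (formal_pure a (b + b') 1) (formal_pure a b 1 + formal_pure a b' 1)"
    using bilinearity_relations.add_right by (simp add: tensor_eq_def algebra_simps)
  show "tensor_eq (formal_pure (c *\<^sub>C a) b 1) (Poly_Mapping.single 0 c * formal_pure a b 1)"
    using bilinearity_relations.scale_left by (simp add: tensor_eq_def mult_single)
  show "tensor_eq (formal_pure a (c *\<^sub>C b) 1) (Poly_Mapping.single 0 c * formal_pure a b 1)"
    using bilinearity_relations.scale_right by (simp add: tensor_eq_def mult_single)
qed

lemma pure_tensor_simps:
  "(a + a') \<otimes>\<^sub>C b = a \<otimes>\<^sub>C b + a' \<otimes>\<^sub>C b" "a \<otimes>\<^sub>C (b + b') = a \<otimes>\<^sub>C b + a \<otimes>\<^sub>C b'"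
  "(c *\<^sub>C a) \<otimes>\<^sub>C b = c *\<^sub>C (a \<otimes>\<^sub>C b)" "a \<otimes>\<^sub>C (c *\<^sub>C b) = c *\<^sub>C (a \<otimes>\<^sub>C b)"
  by (simp_all add: bilinear_pure_tensor[unfolded bilinear_C_def linear_C_def])

lemma pure_tensor_zero [simp]: "0 \<otimes>\<^sub>C b = 0" "a \<otimes>\<^sub>C 0 = 0"
  using pure_tensor_simps(3)[of 0 0 b] pure_tensor_simps(4)[of a 0 0] by (simp_all add: scaleC_zero_left)

lemma pure_tensor_uminus: "(- a) \<otimes>\<^sub>C b = - (a \<otimes>\<^sub>C b)" "a \<otimes>\<^sub>C (- b) = - (a \<otimes>\<^sub>C b)"
  using pure_tensor_simps(3)[of "- 1" a b] pure_tensor_simps(4)[of a "- 1" b]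
  by (simp_all add: scaleC_minus_left scaleC_one)

lemma pure_tensor_diff:
  "(a - a') \<otimes>\<^sub>C b = a \<otimes>\<^sub>C b - a' \<otimes>\<^sub>C b" "a \<otimes>\<^sub>C (b - b') = a \<otimes>\<^sub>C b - a \<otimes>\<^sub>C b'"
  using pure_tensor_simps(1)[of a "- a'" b] pure_tensor_simps(2)[of a b "- b'"]
  by (simp_all add: pure_tensor_uminus)

lemma lin_ext_bilinearity_relations:
  assumes "x \<in> bilinearity_relations" "bilinear_C h"
  shows "lin_ext (case_pair_monoid h) x = 0"
  using assms
  by induction
    (simp_all add: lin_ext_add lin_ext_diff lin_ext_scale scaleC_zero_right scaleC_one
      bilinear_C_def linear_C_def)

lemma tensor_induct [case_names pure scale add]:
  fixes x :: "('a::complex_algebra, 'b::complex_algebra) tensor"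
  assumes "\<And>a b. P (a \<otimes>\<^sub>C b)" "\<And>c x. P x \<Longrightarrow> P (c *\<^sub>C x)" "\<And>x y. P x \<Longrightarrow> P y \<Longrightarrow> P (x + y)"
  shows "P x"
proof (induction x rule: tensor.abs_induct)
  fix y :: "('a, 'b) formal_tensor"
  show "P (abs_tensor y)"
  proof (induction y rule: formal_induct)
    case zero
    show ?case using assms(1)[of 0 0] by (simp flip: zero_tensor.abs_eq)
  next
    case (single k c)
    obtain a b where k: "k = Pair_Monoid a b" by (cases k)
    have "abs_tensor (Poly_Mapping.single k c) = c *\<^sub>C (a \<otimes>\<^sub>C b)"
      by (simp add: k pure_tensor.abs_eq scaleC_tensor.abs_eq mult_single)
    then show ?case using assms(1,2) by simp
  next
    case (add y z)
    then show ?case using assms(3) by (simp flip: plus_tensor.abs_eq)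
  qed
qed

text \<open>The linear map on the tensor product determined by a bilinear map; only applied to maps that
  are bilinear.\<close>

lift_definition tensor_lift ::
    "('a \<Rightarrow> 'b \<Rightarrow> 'c) \<Rightarrow> ('a::complex_algebra, 'b::complex_algebra) tensor \<Rightarrow> 'c::complex_algebra"
  is "\<lambda>h x. if bilinear_C h then lin_ext (case_pair_monoid h) x else 0"
  unfolding tensor_eq_def
  by (metis lin_ext_bilinearity_relations lin_ext_diff eq_iff_diff_eq_0)

lemma tensor_lift_pure:
  "bilinear_C h \<Longrightarrow> tensor_lift h (a \<otimes>\<^sub>C b) = h a b"
  by transfer (simp add: scaleC_one)

lemma linear_tensor_lift: "linear_C (tensor_lift h)"
  unfolding linear_C_def
  by (intro conjI allI; transfer) (simp_all add: lin_ext_add lin_ext_scale scaleC_zero_right)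

definition map_tensor ::
    "('a \<Rightarrow> 'c) \<Rightarrow> ('b \<Rightarrow> 'd) \<Rightarrow> ('a::complex_algebra, 'b::complex_algebra) tensor
      \<Rightarrow> ('c::complex_algebra, 'd::complex_algebra) tensor"
  where "map_tensor f g = tensor_lift (\<lambda>a b. f a \<otimes>\<^sub>C g b)"

lemma map_tensor_pure:
  assumes "linear_C f" "linear_C g"
  shows "map_tensor f g (a \<otimes>\<^sub>C b) = f a \<otimes>\<^sub>C g b"
proof -
  have "bilinear_C (\<lambda>a b. f a \<otimes>\<^sub>C g b)"
    using assms by (simp add: bilinear_C_def linear_C_def pure_tensor_simps)
  then show ?thesis by (simp add: map_tensor_def tensor_lift_pure)
qed

text \<open>The canonical isomorphism \<open>A \<otimes> (B \<otimes> C) \<rightarrow> (A \<otimes> B) \<otimes> C\<close>. Triple tensor products are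
  taken in the form \<open>(A \<otimes> B) \<otimes> C\<close> throughout.\<close>

definition tensor_assoc ::
    "('a::complex_algebra, ('b::complex_algebra, 'c::complex_algebra) tensor) tensor
      \<Rightarrow> (('a, 'b) tensor, 'c) tensor"
  where "tensor_assoc = tensor_lift (\<lambda>a. tensor_lift (\<lambda>b c. a \<otimes>\<^sub>C b \<otimes>\<^sub>C c))"

lemma tensor_assoc_pure:
  fixes a :: "'a::complex_algebra" and b :: "'b::complex_algebra" and c :: "'c::complex_algebra"
  shows "tensor_assoc (a \<otimes>\<^sub>C (b \<otimes>\<^sub>C c)) = a \<otimes>\<^sub>C b \<otimes>\<^sub>C c"
proof -
  define T :: "'a \<Rightarrow> ('b, 'c) tensor \<Rightarrow> (('a, 'b) tensor, 'c) tensor"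
    where "T = (\<lambda>a. tensor_lift (\<lambda>b c. a \<otimes>\<^sub>C b \<otimes>\<^sub>C c))"
  have T_pure: "T a (b \<otimes>\<^sub>C c) = a \<otimes>\<^sub>C b \<otimes>\<^sub>C c" for a b c
    unfolding T_def
    by (rule tensor_lift_pure) (simp add: bilinear_C_def linear_C_def pure_tensor_simps)
  have T_linear: "T a (x + y) = T a x + T a y" "T a (d *\<^sub>C x) = d *\<^sub>C T a x" for a x y d
    by (simp_all add: T_def linear_tensor_lift[unfolded linear_C_def])
  have "T (a + a') x = T a x + T a' x" "T (d *\<^sub>C a) x = d *\<^sub>C T a x" for a a' x d
    by (induction x rule: tensor_induct)
      (simp_all add: T_pure T_linear pure_tensor_simps scaleC_add_right scaleC_scaleC mult.commute
        add_ac)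
  then have "bilinear_C T"
    by (simp add: bilinear_C_def linear_C_def T_linear)
  then show ?thesis
    by (simp add: tensor_assoc_def tensor_lift_pure T_pure flip: T_def)
qed


section \<open>The Hopf algebra Q\<close>

datatype q_generator = Gen_E | Gen_F | Gen_K | Gen_Kinv

datatype 'a word = Word "'a list"

instantiation word :: (type) monoid_add
begin
definition zero_word :: "'a word" where "zero_word = Word []"
fun plus_word :: "'a word \<Rightarrow> 'a word \<Rightarrow> 'a word" where "plus_word (Word u) (Word v) = Word (u @ v)"
instance
proof
  fix x y z :: "'a word"
  show "x + y + z = x + (y + z)" by (cases x; cases y; cases z) simp
  show "0 + x = x" "x + 0 = x" by (cases x; simp add: zero_word_def)+
qed
end

type_synonym free_algebra = "q_generator word \<Rightarrow>\<^sub>0 complex"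

definition free_gen :: "q_generator \<Rightarrow> free_algebra"
  where "free_gen g = Poly_Mapping.single (Word [g]) 1"

definition q_relations :: "free_algebra set"
  where "q_relations =
    (let E = free_gen Gen_E; F = free_gen Gen_F; K = free_gen Gen_K; K' = free_gen Gen_Kinv
     in {K * K' - 1, K' * K - 1,
         K * E * K' + E, K * F * K' + F,
         (E * F - F * E) - Poly_Mapping.single 0 (1 / (2 * \<i>)) * (K - K'),
         E ^ 2, F ^ 2, K ^ 4 - 1})"

inductive_set two_sided_ideal :: "'r::ring_1 set \<Rightarrow> 'r set" for R where
  zero: "0 \<in> two_sided_ideal R"
| generator: "r \<in> R \<Longrightarrow> r \<in> two_sided_ideal R"
| add: "x \<in> two_sided_ideal R \<Longrightarrow> y \<in> two_sided_ideal R \<Longrightarrow> x + y \<in> two_sided_ideal R"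
| mult_left: "x \<in> two_sided_ideal R \<Longrightarrow> a * x \<in> two_sided_ideal R"
| mult_right: "x \<in> two_sided_ideal R \<Longrightarrow> x * a \<in> two_sided_ideal R"

lemma two_sided_ideal_uminus: "x \<in> two_sided_ideal R \<Longrightarrow> - x \<in> two_sided_ideal R"
  using two_sided_ideal.mult_left[of x R "- 1"] by simp

definition q_eq :: "free_algebra \<Rightarrow> free_algebra \<Rightarrow> bool"
  where "q_eq x y \<longleftrightarrow> x - y \<in> two_sided_ideal q_relations"

lemma equivp_q_eq: "equivp q_eq"
proof (rule equivpI)
  show "reflp q_eq"
    by (auto simp: reflp_def q_eq_def two_sided_ideal.zero)
  show "symp q_eq"
    unfolding symp_def q_eq_def using two_sided_ideal_uminus by fastforce
  show "transp q_eq"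
    unfolding transp_def q_eq_def using two_sided_ideal.add by fastforce
qed

quotient_type Q = free_algebra / q_eq
  by (rule equivp_q_eq)

instantiation Q :: complex_algebra
begin

lift_definition zero_Q :: Q is 0 .

lift_definition one_Q :: Q is 1 .

lift_definition plus_Q :: "Q \<Rightarrow> Q \<Rightarrow> Q" is "(+)"
  unfolding q_eq_def using two_sided_ideal.add by (fastforce simp: algebra_simps)

lift_definition uminus_Q :: "Q \<Rightarrow> Q" is uminus
  unfolding q_eq_def using two_sided_ideal_uminus by fastforce

lift_definition minus_Q :: "Q \<Rightarrow> Q \<Rightarrow> Q" is "(-)"
proof -
  fix x x' y y' :: free_algebra
  assume "q_eq x x'" "q_eq y y'"
  then have "(x - x') + - (y - y') \<in> two_sided_ideal q_relations"
    unfolding q_eq_def by (intro two_sided_ideal.add two_sided_ideal_uminus)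
  then show "q_eq (x - y) (x' - y')" by (simp add: q_eq_def algebra_simps)
qed

lift_definition times_Q :: "Q \<Rightarrow> Q \<Rightarrow> Q" is "(*)"
proof -
  fix x x' y y' :: free_algebra
  assume "q_eq x x'" "q_eq y y'"
  then have "(x - x') * y + x' * (y - y') \<in> two_sided_ideal q_relations"
    unfolding q_eq_def
    by (intro two_sided_ideal.add two_sided_ideal.mult_left two_sided_ideal.mult_right)
  then show "q_eq (x * y) (x' * y')" by (simp add: q_eq_def algebra_simps)
qed

lift_definition scaleC_Q :: "complex \<Rightarrow> Q \<Rightarrow> Q"
  is "\<lambda>c x. Poly_Mapping.single 0 c * x"
  unfolding q_eq_def by (simp flip: right_diff_distrib add: two_sided_ideal.mult_left)

instance
proof
  fix x y z :: Q and c d :: complex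
  show "x + y + z = x + (y + z)" by transfer (simp add: q_eq_def two_sided_ideal.zero add.assoc)
  show "x + y = y + x" by transfer (simp add: q_eq_def two_sided_ideal.zero add.commute)
  show "0 + x = x" by transfer (simp add: q_eq_def two_sided_ideal.zero)
  show "- x + x = 0" by transfer (simp add: q_eq_def two_sided_ideal.zero)
  show "x - y = x + - y" by transfer (simp add: q_eq_def two_sided_ideal.zero)
  show "x * y * z = x * (y * z)" by transfer (simp add: q_eq_def two_sided_ideal.zero mult.assoc)
  show "1 * x = x" "x * 1 = x" by (transfer, simp add: q_eq_def two_sided_ideal.zero)+
  show "(x + y) * z = x * z + y * z"
    by transfer (simp add: q_eq_def two_sided_ideal.zero distrib_right)
  show "x * (y + z) = x * y + x * z"
    by transfer (simp add: q_eq_def two_sided_ideal.zero distrib_left)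
  show "c *\<^sub>C (x + y) = c *\<^sub>C x + c *\<^sub>C y"
    by transfer (simp add: q_eq_def two_sided_ideal.zero distrib_left)
  show "(c + d) *\<^sub>C x = c *\<^sub>C x + d *\<^sub>C x"
    by transfer (simp add: q_eq_def two_sided_ideal.zero single_add distrib_right)
  show "c *\<^sub>C d *\<^sub>C x = (c * d) *\<^sub>C x"
    by transfer (simp add: q_eq_def two_sided_ideal.zero mult_single flip: mult.assoc)
  show "1 *\<^sub>C x = x"
    by transfer (simp add: q_eq_def two_sided_ideal.zero)
  show "(c *\<^sub>C x) * y = c *\<^sub>C (x * y)"
    by transfer (simp add: q_eq_def two_sided_ideal.zero mult.assoc)
  show "x * (c *\<^sub>C y) = c *\<^sub>C (x * y)"
    by transfer (metis cancel_comm_monoid_add_class.diff_cancel q_eq_def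
        two_sided_ideal.zero mult.assoc single_zero_commute)
qed

end

lift_definition q_gen :: "q_generator \<Rightarrow> Q" is free_gen .

abbreviation qE :: Q where "qE \<equiv> q_gen Gen_E"
abbreviation qF :: Q where "qF \<equiv> q_gen Gen_F"
abbreviation qK :: Q where "qK \<equiv> q_gen Gen_K"
abbreviation qKinv :: Q where "qKinv \<equiv> q_gen Gen_Kinv"

lemma q_relations_hold:
  "qK * qKinv = 1" "qKinv * qK = 1"
  "qK * qE * qKinv = - qE" "qK * qF * qKinv = - qF"
  "qE * qF - qF * qE = (1 / (2 * \<i>)) *\<^sub>C (qK - qKinv)"
  "qE * qE = 0" "qF * qF = 0" "qK * qK * qK * qK = 1"
  by (transfer, simp add: q_eq_def, rule two_sided_ideal.generator,
      simp add: q_relations_def Let_def power_numeral_reduce power2_eq_square mult.assoc)+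

text \<open>The algebra homomorphism from the free algebra with prescribed values on the generators.\<close>

fun word_value :: "('g \<Rightarrow> 'v) \<Rightarrow> 'g word \<Rightarrow> 'v::complex_algebra"
  where "word_value f (Word w) = prod_list (map f w)"

lemma word_value_add: "word_value f (u + v) = word_value f u * word_value f v"
  by (cases u; cases v) simp

definition free_hom :: "(q_generator \<Rightarrow> 'v) \<Rightarrow> free_algebra \<Rightarrow> 'v::complex_algebra"
  where "free_hom f = lin_ext (word_value f)"

lemma free_hom_simps:
  "free_hom f 0 = 0" "free_hom f 1 = 1"
  "free_hom f (x + y) = free_hom f x + free_hom f y"
  "free_hom f (x - y) = free_hom f x - free_hom f y"
  "free_hom f (x * y) = free_hom f x * free_hom f y"
  "free_hom f (x ^ n) = free_hom f x ^ n"
  "free_hom f (Poly_Mapping.single 0 c) = c *\<^sub>C 1"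
  "free_hom f (free_gen g) = f g"
proof -
  show mult: "free_hom f (x * y) = free_hom f x * free_hom f y" for x y
    by (simp add: free_hom_def lin_ext_mult word_value_add)
  show one: "free_hom f 1 = 1"
    by (simp add: free_hom_def zero_word_def scaleC_one flip: single_one)
  show "free_hom f (x ^ n) = free_hom f x ^ n"
    by (induction n) (simp_all add: mult one)
qed (simp_all add: free_hom_def lin_ext_add lin_ext_diff free_gen_def scaleC_one zero_word_def)

lemma free_hom_ideal:
  assumes "x \<in> two_sided_ideal q_relations" "\<And>r. r \<in> q_relations \<Longrightarrow> free_hom f r = 0"
  shows "free_hom f x = 0"
  using assms by induction (simp_all add: free_hom_simps)

lemma free_hom_q_eq:
  assumes "q_eq x y" "\<And>r. r \<in> q_relations \<Longrightarrow> free_hom f r = 0"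
  shows "free_hom f x = free_hom f y"
  using free_hom_ideal[OF assms(1)[unfolded q_eq_def] assms(2)] by (simp add: free_hom_simps)

fun coproduct_gen :: "q_generator \<Rightarrow> (Q, Q) tensor" where
  "coproduct_gen Gen_E = 1 \<otimes>\<^sub>C qE + qE \<otimes>\<^sub>C qK"
| "coproduct_gen Gen_F = qKinv \<otimes>\<^sub>C qF + qF \<otimes>\<^sub>C 1"
| "coproduct_gen Gen_K = qK \<otimes>\<^sub>C qK"
| "coproduct_gen Gen_Kinv = qKinv \<otimes>\<^sub>C qKinv"

fun counit_gen :: "q_generator \<Rightarrow> complex" where
  "counit_gen Gen_E = 0"
| "counit_gen Gen_F = 0"
| "counit_gen Gen_K = 1"
| "counit_gen Gen_Kinv = 1"

lemma q_commute:
  "qK * qE = - (qE * qK)" "qK * qF = - (qF * qK)"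
  "qKinv * qE = - (qE * qKinv)" "qKinv * qF = - (qF * qKinv)"
  "qF * qE = qE * qF - (1 / (2 * \<i>)) *\<^sub>C (qK - qKinv)"
proof -
  note R = q_relations_hold
  have K: "qK * x = - (x * qK)" and Kinv: "qKinv * x = - (x * qKinv)"
    if "qK * x * qKinv = - x" for x
  proof -
    have "qK * x * qKinv * qK = - (x * qK)" by (simp add: that)
    then show 1: "qK * x = - (x * qK)" by (simp add: mult.assoc R)
    have "qKinv * (qK * x) * qKinv = - (qKinv * (x * qK) * qKinv)" by (simp add: 1)
    then have "x * qKinv = - (qKinv * x)"
      by (simp add: mult.assoc R) (simp add: R flip: mult.assoc)
    then show "qKinv * x = - (x * qKinv)" by simp
  qed
  show "qK * qE = - (qE * qK)" "qK * qF = - (qF * qK)" by (rule K, rule R)+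
  show "qKinv * qE = - (qE * qKinv)" "qKinv * qF = - (qF * qKinv)" by (rule Kinv, rule R)+
  show "qF * qE = qE * qF - (1 / (2 * \<i>)) *\<^sub>C (qK - qKinv)"
    by (subst R(5)[symmetric]) simp
qed

lemma coproduct_gen_relations:
  assumes "r \<in> q_relations" shows "free_hom coproduct_gen r = 0"
proof -
  note R = q_relations_hold q_commute
  let ?E = "1 \<otimes>\<^sub>C qE + qE \<otimes>\<^sub>C qK" and ?F = "qKinv \<otimes>\<^sub>C qF + qF \<otimes>\<^sub>C 1"
    and ?K = "qK \<otimes>\<^sub>C qK" and ?K' = "qKinv \<otimes>\<^sub>C qKinv"
  note S = distrib_left distrib_right pure_tensor_mult pure_tensor_uminus pure_tensor_diff
    pure_tensor_simps scaleC_minus_right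
  have 1: "?K * ?K' = 1" "?K' * ?K = 1"
    by (simp_all add: pure_tensor_mult R one_tensor)
  have 2: "?K * ?E * ?K' = - ?E" "?K * ?F * ?K' = - ?F"
    by (simp_all add: S R left_diff_distrib mult.assoc)
  have "?E * ?F - ?F * ?E = qKinv \<otimes>\<^sub>C (qE * qF - qF * qE) + (qE * qF - qF * qE) \<otimes>\<^sub>C qK"
    by (simp add: S R(9-12))
  also have "\<dots> = (1 / (2 * \<i>)) *\<^sub>C (?K - ?K')"
    unfolding R(5) by (simp add: pure_tensor_simps pure_tensor_diff flip: scaleC_add_right)
  finally have 3: "?E * ?F - ?F * ?E = (1 / (2 * \<i>)) *\<^sub>C (?K - ?K')" .
  have 4: "?E * ?E = 0" "?F * ?F = 0"
    by (simp_all add: S R)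
  have 5: "?K * ?K * ?K * ?K = 1"
    by (simp add: pure_tensor_mult R one_tensor)
  show ?thesis
    using assms 1 2 3 4 5 unfolding q_relations_def Let_def
    by (elim insertE emptyE)
      (simp_all add: free_hom_simps power_numeral_reduce power2_eq_square mult_scaleC_left mult.assoc)
qed

lift_definition coproduct :: "Q \<Rightarrow> (Q, Q) tensor" ("\<Delta>") is "free_hom coproduct_gen"
  by (rule free_hom_q_eq[OF _ coproduct_gen_relations])

lift_definition counit :: "Q \<Rightarrow> complex" ("\<epsilon>") is "free_hom counit_gen"
proof (rule free_hom_q_eq)
  fix r assume "r \<in> q_relations"
  then show "free_hom counit_gen r = 0"
    by (auto simp: q_relations_def Let_def free_hom_simps scaleC_complex_def)
qed

lemma coproduct_simps:
  "\<Delta> (x + y) = \<Delta> x + \<Delta> y" "\<Delta> (c *\<^sub>C x) = c *\<^sub>C \<Delta> x" "\<Delta> (x * y) = \<Delta> x * \<Delta> y" "\<Delta> 1 = 1"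
  "\<Delta> qE = 1 \<otimes>\<^sub>C qE + qE \<otimes>\<^sub>C qK" "\<Delta> qF = qKinv \<otimes>\<^sub>C qF + qF \<otimes>\<^sub>C 1" "\<Delta> qK = qK \<otimes>\<^sub>C qK"
proof -
  show "\<Delta> (x + y) = \<Delta> x + \<Delta> y" "\<Delta> (x * y) = \<Delta> x * \<Delta> y"
    by (induction x rule: Q.abs_induct, induction y rule: Q.abs_induct,
        simp add: coproduct.abs_eq plus_Q.abs_eq times_Q.abs_eq free_hom_simps)+
  show "\<Delta> (c *\<^sub>C x) = c *\<^sub>C \<Delta> x"
    by (induction x rule: Q.abs_induct)
      (simp add: coproduct.abs_eq scaleC_Q.abs_eq free_hom_simps mult_scaleC_left)
  have "\<Delta> (abs_Q u) = free_hom coproduct_gen u" for u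
    by (rule coproduct.abs_eq)
  from this[of 1] this[of "free_gen _"] show "\<Delta> 1 = 1"
    "\<Delta> qE = 1 \<otimes>\<^sub>C qE + qE \<otimes>\<^sub>C qK" "\<Delta> qF = qKinv \<otimes>\<^sub>C qF + qF \<otimes>\<^sub>C 1" "\<Delta> qK = qK \<otimes>\<^sub>C qK"
    by (simp_all add: free_hom_simps flip: one_Q_def q_gen.abs_eq)
qed

lemma counit_simps:
  "\<epsilon> (x + y) = \<epsilon> x + \<epsilon> y" "\<epsilon> (c *\<^sub>C x) = c * \<epsilon> x" "\<epsilon> (x * y) = \<epsilon> x * \<epsilon> y" "\<epsilon> 1 = 1"
  "\<epsilon> qE = 0" "\<epsilon> qF = 0" "\<epsilon> qK = 1"
proof -
  show "\<epsilon> (x + y) = \<epsilon> x + \<epsilon> y" "\<epsilon> (x * y) = \<epsilon> x * \<epsilon> y"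
    by (induction x rule: Q.abs_induct, induction y rule: Q.abs_induct,
        simp add: counit.abs_eq plus_Q.abs_eq times_Q.abs_eq free_hom_simps)+
  show "\<epsilon> (c *\<^sub>C x) = c * \<epsilon> x"
    by (induction x rule: Q.abs_induct)
      (simp add: counit.abs_eq scaleC_Q.abs_eq free_hom_simps scaleC_complex_def)
qed (simp_all add: one_Q_def q_gen.abs_eq counit.abs_eq free_hom_simps)

text \<open>The maps \<open>\<Delta> \<otimes> id\<close> and \<open>id \<otimes> \<Delta>\<close> from \<open>Q \<otimes> Q\<close> to \<open>(Q \<otimes> Q) \<otimes> Q\<close>, and
  \<open>\<epsilon> \<otimes> id\<close> and \<open>id \<otimes> \<epsilon>\<close> from \<open>Q \<otimes> Q\<close> to \<open>Q\<close>.\<close>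

definition coproduct_id :: "(Q, Q) tensor \<Rightarrow> ((Q, Q) tensor, Q) tensor"
  where "coproduct_id = map_tensor \<Delta> id"

definition id_coproduct :: "(Q, Q) tensor \<Rightarrow> ((Q, Q) tensor, Q) tensor"
  where "id_coproduct x = tensor_assoc (map_tensor id \<Delta> x)"

definition counit_id :: "(Q, Q) tensor \<Rightarrow> Q"
  where "counit_id = tensor_lift (\<lambda>a b. \<epsilon> a *\<^sub>C b)"

definition id_counit :: "(Q, Q) tensor \<Rightarrow> Q"
  where "id_counit = tensor_lift (\<lambda>a b. \<epsilon> b *\<^sub>C a)"

lemma linear_maps: "linear_C \<Delta>" "linear_C \<epsilon>" "linear_C id"
  by (simp_all add: linear_C_def coproduct_simps counit_simps scaleC_complex_def)

lemma coproduct_counit_pure: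
  "coproduct_id (a \<otimes>\<^sub>C b) = \<Delta> a \<otimes>\<^sub>C b"
  "id_coproduct (a \<otimes>\<^sub>C b) = tensor_assoc (a \<otimes>\<^sub>C \<Delta> b)"
  "counit_id (a \<otimes>\<^sub>C b) = \<epsilon> a *\<^sub>C b"
  "id_counit (a \<otimes>\<^sub>C b) = \<epsilon> b *\<^sub>C a"
proof -
  show "coproduct_id (a \<otimes>\<^sub>C b) = \<Delta> a \<otimes>\<^sub>C b" "id_coproduct (a \<otimes>\<^sub>C b) = tensor_assoc (a \<otimes>\<^sub>C \<Delta> b)"
    by (simp_all add: coproduct_id_def id_coproduct_def map_tensor_pure linear_maps)
  show "counit_id (a \<otimes>\<^sub>C b) = \<epsilon> a *\<^sub>C b" "id_counit (a \<otimes>\<^sub>C b) = \<epsilon> b *\<^sub>C a"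
    unfolding counit_id_def id_counit_def
    by (rule tensor_lift_pure,
        simp add: bilinear_C_def linear_C_def counit_simps scaleC_add_left scaleC_add_right
          scaleC_scaleC mult.commute)+
qed


section \<open>The coassociator\<close>

definition e0 :: Q where "e0 = (1 / 2) *\<^sub>C (1 + qK ^ 2)"
definition e1 :: Q where "e1 = (1 / 2) *\<^sub>C (1 - qK ^ 2)"

definition Phi010 :: "((Q, Q) tensor, Q) tensor"
  where "Phi010 = (let E = qE; F = qF; K = qK in
      1 \<otimes>\<^sub>C 1 \<otimes>\<^sub>C 1
    - (1 + \<i>) *\<^sub>C E \<otimes>\<^sub>C K \<otimes>\<^sub>C F
    + (1 - \<i>) *\<^sub>C F * K \<otimes>\<^sub>C K \<otimes>\<^sub>C E * K
    + 2 *\<^sub>C E * F * K \<otimes>\<^sub>C 1 \<otimes>\<^sub>C E * F * K)"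

definition Phi101 :: "((Q, Q) tensor, Q) tensor"
  where "Phi101 = (let E = qE; F = qF; K = qK in
      (\<i> - 1) *\<^sub>C 1 \<otimes>\<^sub>C F \<otimes>\<^sub>C E * K
    + 1 \<otimes>\<^sub>C K \<otimes>\<^sub>C 1
    + 2 *\<^sub>C 1 \<otimes>\<^sub>C E * F \<otimes>\<^sub>C E * F * K
    - (1 + \<i>) *\<^sub>C 1 \<otimes>\<^sub>C E * K \<otimes>\<^sub>C F
    - (1 + \<i>) *\<^sub>C E \<otimes>\<^sub>C F * K \<otimes>\<^sub>C 1
    + (2 * \<i>) *\<^sub>C E \<otimes>\<^sub>C E * F * K \<otimes>\<^sub>C F
    + (1 - \<i>) *\<^sub>C F * K \<otimes>\<^sub>C E \<otimes>\<^sub>C 1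
    - (2 * \<i>) *\<^sub>C F * K \<otimes>\<^sub>C E * F * K \<otimes>\<^sub>C E * K
    - 2 *\<^sub>C E * F * K \<otimes>\<^sub>C E * F \<otimes>\<^sub>C 1)"

definition Phi111 :: "complex \<Rightarrow> ((Q, Q) tensor, Q) tensor"
  where "Phi111 \<beta> = (let E = qE; F = qF; K = qK in
    (\<i> * \<beta>\<^sup>2) *\<^sub>C (
      (1 + \<i>) *\<^sub>C 1 \<otimes>\<^sub>C F \<otimes>\<^sub>C E * K
    - 1 \<otimes>\<^sub>C K \<otimes>\<^sub>C 1
    - 2 *\<^sub>C 1 \<otimes>\<^sub>C E * F \<otimes>\<^sub>C 1
    - (2 * \<i>) *\<^sub>C 1 \<otimes>\<^sub>C E * F \<otimes>\<^sub>C E * F * K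
    + (1 + \<i>) *\<^sub>C 1 \<otimes>\<^sub>C E * K \<otimes>\<^sub>C F
    - (1 + \<i>) *\<^sub>C E \<otimes>\<^sub>C 1 \<otimes>\<^sub>C F
    + (1 + \<i>) *\<^sub>C E \<otimes>\<^sub>C F * K \<otimes>\<^sub>C 1
    + (2 * \<i>) *\<^sub>C E \<otimes>\<^sub>C F * K \<otimes>\<^sub>C E * F * K
    + 2 *\<^sub>C E \<otimes>\<^sub>C E * F * K \<otimes>\<^sub>C F
    - (1 + \<i>) *\<^sub>C F * K \<otimes>\<^sub>C 1 \<otimes>\<^sub>C E * K
    + (1 + \<i>) *\<^sub>C F * K \<otimes>\<^sub>C E \<otimes>\<^sub>C 1
    + (2 * \<i>) *\<^sub>C F * K \<otimes>\<^sub>C E \<otimes>\<^sub>C E * F * K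
    + 2 *\<^sub>C F * K \<otimes>\<^sub>C E * F * K \<otimes>\<^sub>C E * K
    + (2 * \<i>) *\<^sub>C E * F * K \<otimes>\<^sub>C F \<otimes>\<^sub>C E * K
    + (2 * \<i>) *\<^sub>C E * F * K \<otimes>\<^sub>C K \<otimes>\<^sub>C E * F * K
    - (2 * \<i>) *\<^sub>C E * F * K \<otimes>\<^sub>C E * F \<otimes>\<^sub>C 1
    + (2 * \<i>) *\<^sub>C E * F * K \<otimes>\<^sub>C E * K \<otimes>\<^sub>C F
    + 4 *\<^sub>C E * F * K \<otimes>\<^sub>C E * F \<otimes>\<^sub>C E * F * K))"

definition coassociator :: "complex \<Rightarrow> ((Q, Q) tensor, Q) tensor"
  where "coassociator \<beta> =
      e0 \<otimes>\<^sub>C e0 \<otimes>\<^sub>C e0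
    + e1 \<otimes>\<^sub>C e0 \<otimes>\<^sub>C e0
    + Phi010 * (e0 \<otimes>\<^sub>C e1 \<otimes>\<^sub>C e0)
    + e0 \<otimes>\<^sub>C e0 \<otimes>\<^sub>C e1
    + e1 \<otimes>\<^sub>C e1 \<otimes>\<^sub>C e0
    + Phi101 * (e1 \<otimes>\<^sub>C e0 \<otimes>\<^sub>C e1)
    + e0 \<otimes>\<^sub>C e1 \<otimes>\<^sub>C e1
    + Phi111 \<beta> * (e1 \<otimes>\<^sub>C e1 \<otimes>\<^sub>C e1)"


section \<open>Finite-dimensional modules and monoidal structures on the identity functor\<close>

text \<open>A finite-dimensional \<open>Q\<close>-module is represented, after a choice of basis, by its dimension \<open>n\<close>
  and the matrices by which the elements of \<open>Q\<close> act on \<open>\<complex>\<^sup>n\<close>. In tensor products, the basis vector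
  \<open>b\<^sub>i \<otimes> b\<^sub>j\<close> of \<open>\<complex>\<^sup>n \<otimes> \<complex>\<^sup>m\<close> has index \<open>i * m + j\<close>. With this numbering, the canonical maps
  \<open>\<complex>\<^sup>n \<otimes> (\<complex>\<^sup>m \<otimes> \<complex>\<^sup>p) \<rightarrow> (\<complex>\<^sup>n \<otimes> \<complex>\<^sup>m) \<otimes> \<complex>\<^sup>p\<close>, \<open>\<complex> \<otimes> \<complex>\<^sup>n \<rightarrow> \<complex>\<^sup>n\<close> and \<open>\<complex>\<^sup>n \<otimes> \<complex> \<rightarrow> \<complex>\<^sup>n\<close> of vector spaces
  are given by identity matrices.\<close>

type_synonym q_module = "nat \<times> (Q \<Rightarrow> complex mat)"

abbreviation vdim :: "q_module \<Rightarrow> nat" where "vdim \<equiv> fst"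
abbreviation act :: "q_module \<Rightarrow> Q \<Rightarrow> complex mat" where "act \<equiv> snd"

definition is_module :: "q_module \<Rightarrow> bool"
  where "is_module U \<longleftrightarrow>
    (\<forall>a. act U a \<in> carrier_mat (vdim U) (vdim U)) \<and>
    (\<forall>a b. act U (a + b) = act U a + act U b) \<and>
    (\<forall>c a. act U (c *\<^sub>C a) = c \<cdot>\<^sub>m act U a) \<and>
    act U 1 = 1\<^sub>m (vdim U) \<and>
    (\<forall>a b. act U (a * b) = act U a * act U b)"

definition module_hom :: "q_module \<Rightarrow> q_module \<Rightarrow> complex mat set"
  where "module_hom U V =
    {f \<in> carrier_mat (vdim V) (vdim U). \<forall>a. f * act U a = act V a * f}"

definition kronecker :: "complex mat \<Rightarrow> complex mat \<Rightarrow> complex mat"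
  where "kronecker A B = mat (dim_row A * dim_row B) (dim_col A * dim_col B)
    (\<lambda>(i, j). A $$ (i div dim_row B, j div dim_col B) * B $$ (i mod dim_row B, j mod dim_col B))"

text \<open>The action of \<open>A \<otimes> B\<close> on \<open>\<complex>\<^sup>n \<otimes> \<complex>\<^sup>m\<close> obtained from actions \<open>\<rho>\<close> of \<open>A\<close> on \<open>\<complex>\<^sup>n\<close> and \<open>\<sigma>\<close>
  of \<open>B\<close> on \<open>\<complex>\<^sup>m\<close>: the linear extension of \<open>a \<otimes> b \<mapsto> kronecker (\<rho> a) (\<sigma> b)\<close>.\<close>

definition tensor_act ::
    "nat \<Rightarrow> ('a \<Rightarrow> complex mat) \<Rightarrow> nat \<Rightarrow> ('b \<Rightarrow> complex mat)
      \<Rightarrow> ('a::complex_algebra, 'b::complex_algebra) tensor \<Rightarrow> complex mat"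
  where "tensor_act n \<rho> m \<sigma> x = mat (n * m) (n * m)
    (\<lambda>(i, j). tensor_lift (\<lambda>a b. kronecker (\<rho> a) (\<sigma> b) $$ (i, j)) x)"

definition act2 :: "q_module \<Rightarrow> q_module \<Rightarrow> (Q, Q) tensor \<Rightarrow> complex mat"
  where "act2 U V = tensor_act (vdim U) (act U) (vdim V) (act V)"

definition act3 :: "q_module \<Rightarrow> q_module \<Rightarrow> q_module \<Rightarrow> ((Q, Q) tensor, Q) tensor \<Rightarrow> complex mat"
  where "act3 U V W = tensor_act (vdim U * vdim V) (act2 U V) (vdim W) (act W)"

definition module_tensor :: "q_module \<Rightarrow> q_module \<Rightarrow> q_module"  (infixl "\<otimes>\<^sub>Q" 70)
  where "U \<otimes>\<^sub>Q V = (vdim U * vdim V, \<lambda>a. act2 U V (\<Delta> a))"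

definition unit_module :: q_module
  where "unit_module = (1, \<lambda>a. \<epsilon> a \<cdot>\<^sub>m 1\<^sub>m 1)"

text \<open>\<open>J\<close> (with components \<open>J U V : U \<otimes> V \<rightarrow> U \<otimes> V\<close>) and \<open>\<phi> : \<one> \<rightarrow> \<one>\<close> make the identity functor a
  monoidal functor from \<open>Rep (Q, \<Phi>)\<close> to \<open>Rep Q\<close>. The associator \<open>U \<otimes> (V \<otimes> W) \<rightarrow> (U \<otimes> V) \<otimes> W\<close>
  is the action of \<open>\<Phi>\<close> in the source and the canonical map of vector spaces in the target; the unit
  isomorphisms are the canonical ones in both categories.\<close>

definition monoidal_identity ::
    "((Q, Q) tensor, Q) tensor \<Rightarrow> (q_module \<Rightarrow> q_module \<Rightarrow> complex mat) \<Rightarrow> complex mat \<Rightarrow> bool"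
  where "monoidal_identity \<Phi> J \<phi> \<longleftrightarrow>
    (\<forall>U V. is_module U \<longrightarrow> is_module V \<longrightarrow>
      J U V \<in> module_hom (U \<otimes>\<^sub>Q V) (U \<otimes>\<^sub>Q V) \<and> invertible_mat (J U V)) \<and>
    (\<forall>U U' V V'. is_module U \<longrightarrow> is_module U' \<longrightarrow> is_module V \<longrightarrow> is_module V' \<longrightarrow>
      (\<forall>f \<in> module_hom U U'. \<forall>g \<in> module_hom V V'.
        J U' V' * kronecker f g = kronecker f g * J U V)) \<and>
    \<phi> \<in> module_hom unit_module unit_module \<and> invertible_mat \<phi> \<and>
    (\<forall>U V W. is_module U \<longrightarrow> is_module V \<longrightarrow> is_module W \<longrightarrow>
      act3 U V W \<Phi> * J U (V \<otimes>\<^sub>Q W) * kronecker (1\<^sub>m (vdim U)) (J V W) =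
      J (U \<otimes>\<^sub>Q V) W * kronecker (J U V) (1\<^sub>m (vdim W))) \<and>
    (\<forall>U. is_module U \<longrightarrow>
      J unit_module U * kronecker \<phi> (1\<^sub>m (vdim U)) = 1\<^sub>m (vdim U) \<and>
      J U unit_module * kronecker (1\<^sub>m (vdim U)) \<phi> = 1\<^sub>m (vdim U))"

end

theory Submission
  imports Defs
begin

text \<open>
  A twist \<open>\<F>\<close> acts on tensor products of modules and makes the identity functor monoidal, so only
  the second claim needs an obstruction. It comes from two modules: the one-dimensional \<open>X\<close> on
  which \<open>E\<close>, \<open>F\<close> act by \<open>0\<close> and \<open>K\<close> by \<open>- 1\<close>, and a two-dimensional simple module \<open>T\<close> on which
  \<open>K\<^sup>2 = - 1\<close>. By Schur's lemma \<open>J X T = a\<close> and \<open>J T X = b\<close> are scalars. The components of \<open>\<Phi>\<close> on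
  \<open>X X T\<close>, \<open>X T X\<close>, \<open>T X X\<close> are trivial, \<open>X \<otimes> X\<close> is the unit, and the action of \<open>K\<close> on \<open>T\<close>
  is an isomorphism from \<open>X \<otimes> T\<close> to \<open>T \<otimes> X\<close>; this gives \<open>b\<^sup>2 = a\<^sup>2\<close>. On \<open>X T T\<close> and \<open>T T X\<close> the
  action of \<open>\<Phi>\<close> is again trivial, but on \<open>T X T\<close> it is \<open>- 1\<close>. Evaluating the three compatibility
  conditions on the invariant vector of \<open>T \<otimes> T\<close>, where \<open>J X (T \<otimes> T)\<close> and \<open>J (T \<otimes> T) X\<close> are both
  determined by the unit axiom, gives \<open>b\<^sup>2 = - a\<^sup>2\<close>.
\<close>

subsection \<open>Kronecker products\<close>

lemma kronecker_dim [simp]: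
  "dim_row (kronecker A B) = dim_row A * dim_row B"
  "dim_col (kronecker A B) = dim_col A * dim_col B"
  by (simp_all add: kronecker_def)

lemma kronecker_carrier [intro, simp]:
  assumes "A \<in> carrier_mat n m" "B \<in> carrier_mat p q"
  shows "kronecker A B \<in> carrier_mat (n * p) (m * q)"
  using assms by (auto simp: kronecker_def)

lemma kronecker_index:
  assumes "i < dim_row A * dim_row B" "j < dim_col A * dim_col B"
  shows "kronecker A B $$ (i, j) =
    A $$ (i div dim_row B, j div dim_col B) * B $$ (i mod dim_row B, j mod dim_col B)"
  using assms by (simp add: kronecker_def)

lemma index_split_bounds:
  fixes i n m :: nat
  assumes "i < n * m" shows "i div m < n" "i mod m < m"
proof -
  from assms have "0 < m" by (cases m) auto
  with assms show "i div m < n" "i mod m < m"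
    by (auto simp: less_mult_imp_div_less)
qed

lemma index_join_bound:
  fixes s t m q :: nat
  assumes "s < m" "t < q" shows "s * q + t < m * q"
proof -
  have "s * q + t < Suc s * q" using assms(2) by simp
  also have "\<dots> \<le> m * q" using assms(1) by (intro mult_le_mono1) simp
  finally show ?thesis .
qed

text \<open>The summation index \<open>r < m * q\<close> is a pair of digits
  \<open>(r div q, r mod q)\<close>, so the single sum becomes a double sum that factors into the
  two matrix products.\<close>

lemma kronecker_mult:
  assumes "A \<in> carrier_mat n m" "B \<in> carrier_mat p q"
    and "C \<in> carrier_mat m k" "D \<in> carrier_mat q l"
  shows "kronecker A B * kronecker C D = kronecker (A * C) (B * D)"
proof (rule eq_matI)
  fix i j assume "i < dim_row (kronecker (A * C) (B * D))" "j < dim_col (kronecker (A * C) (B * D))"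
  then have i: "i < n * p" and j: "j < k * l" using assms by auto
  note ib = index_split_bounds[OF i] and jb = index_split_bounds[OF j]
  have "(kronecker A B * kronecker C D) $$ (i, j) =
    (\<Sum>r<m * q. kronecker A B $$ (i, r) * kronecker C D $$ (r, j))"
    using i j assms by (simp add: scalar_prod_def lessThan_atLeast0 carrier_matD[OF assms(1)]
        carrier_matD[OF assms(2)] carrier_matD[OF assms(3)] carrier_matD[OF assms(4)])
  also have "\<dots> = (\<Sum>r<m * q. (A $$ (i div p, r div q) * C $$ (r div q, j div l)) *
      (B $$ (i mod p, r mod q) * D $$ (r mod q, j mod l)))"
    by (rule sum.cong) (use i j assms in \<open>auto simp: kronecker_index\<close>)
  also have "\<dots> = (\<Sum>(s, t)\<in>{..<m} \<times> {..<q}. (A $$ (i div p, s) * C $$ (s, j div l)) *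
      (B $$ (i mod p, t) * D $$ (t, j mod l)))"
    by (rule sum.reindex_bij_witness[where i = "\<lambda>(s, t). s * q + t" and j = "\<lambda>r. (r div q, r mod q)"])
      (auto simp: index_split_bounds index_join_bound)
  also have "\<dots> = (A * C) $$ (i div p, j div l) * (B * D) $$ (i mod p, j mod l)"
    using ib jb assms
    by (simp add: scalar_prod_def sum_product sum.cartesian_product lessThan_atLeast0)
  also have "\<dots> = kronecker (A * C) (B * D) $$ (i, j)"
    using i j assms by (simp add: kronecker_index)
  finally show "(kronecker A B * kronecker C D) $$ (i, j) = kronecker (A * C) (B * D) $$ (i, j)" .
qed (use assms in auto)

lemma kronecker_one: "kronecker (1\<^sub>m n) (1\<^sub>m m) = 1\<^sub>m (n * m)"
proof (rule eq_matI)
  fix i j assume "i < dim_row (1\<^sub>m (n * m))" "j < dim_col (1\<^sub>m (n * m))"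
  then have ij: "i < n * m" "j < n * m" by auto
  have "i = j \<longleftrightarrow> i div m = j div m \<and> i mod m = j mod m"
    by (metis div_mult_mod_eq)
  then show "kronecker (1\<^sub>m n) (1\<^sub>m m) $$ (i, j) = 1\<^sub>m (n * m) $$ (i, j)"
    using ij by (auto simp: kronecker_index index_split_bounds)
qed auto

text \<open>Both bracketings split an index into the same three mixed-radix digits. This is why the
  canonical map between the two triple tensor products of vector spaces is an identity
  matrix.\<close>

lemma kronecker_assoc: "kronecker (kronecker A B) C = kronecker A (kronecker B C)"
proof (rule eq_matI)
  fix i j
  assume "i < dim_row (kronecker A (kronecker B C))" "j < dim_col (kronecker A (kronecker B C))"
  then have i: "i < dim_row A * dim_row B * dim_row C" "i < dim_row A * (dim_row B * dim_row C)"
    and j: "j < dim_col A * dim_col B * dim_col C" "j < dim_col A * (dim_col B * dim_col C)"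
    by (auto simp: mult.assoc)
  have split: "i div c div b = i div (b * c)" "i div c mod b = i mod (b * c) div c"
    "i mod (b * c) mod c = i mod c" for i b c :: nat
    by (simp_all add: div_mult2_eq mult.commute[of b c] mod_mult2_eq)
       (cases "c = 0"; simp add: mult.commute)+
  note b = index_split_bounds[OF i(1)] index_split_bounds[OF i(2)]
    index_split_bounds[OF j(1)] index_split_bounds[OF j(2)]
  show "kronecker (kronecker A B) C $$ (i, j) = kronecker A (kronecker B C) $$ (i, j)"
    using i j b by (simp add: kronecker_index split mult.assoc)
qed (auto simp: mult.assoc)

lemma kronecker_zero [simp]:
  "kronecker (0\<^sub>m n m) B = 0\<^sub>m (n * dim_row B) (m * dim_col B)"
  "kronecker A (0\<^sub>m n m) = 0\<^sub>m (dim_row A * n) (dim_col A * m)"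
  by (rule eq_matI; simp add: kronecker_index index_split_bounds)+

lemma kronecker_smult:
  "kronecker (c \<cdot>\<^sub>m A) B = c \<cdot>\<^sub>m kronecker A B"
  "kronecker A (c \<cdot>\<^sub>m B) = c \<cdot>\<^sub>m kronecker A B"
  by (rule eq_matI; simp add: kronecker_index index_split_bounds mult_ac)+

lemma kronecker_one_dim:
  "kronecker (1\<^sub>m 1) A = A" "kronecker A (1\<^sub>m 1) = A"
  by (rule eq_matI; simp add: kronecker_index)+


subsection \<open>Matrix representations and their tensor products\<close>

lemma tensor_assoc_linear:
  "tensor_assoc (x + y) = tensor_assoc x + tensor_assoc y"
  "tensor_assoc (c *\<^sub>C x) = c *\<^sub>C tensor_assoc x"
  using linear_tensor_lift unfolding tensor_assoc_def linear_C_def by blast+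

text \<open>The module axioms over an arbitrary complex algebra, so that the actions of the tensor
  square and the tensor cube of \<open>Q\<close> are covered as well.\<close>

definition matrix_rep :: "nat \<Rightarrow> ('a::complex_algebra \<Rightarrow> complex mat) \<Rightarrow> bool"
  where "matrix_rep n \<rho> \<longleftrightarrow>
    (\<forall>a. \<rho> a \<in> carrier_mat n n) \<and>
    (\<forall>a b. \<rho> (a + b) = \<rho> a + \<rho> b) \<and>
    (\<forall>c a. \<rho> (c *\<^sub>C a) = c \<cdot>\<^sub>m \<rho> a) \<and>
    \<rho> 1 = 1\<^sub>m n \<and>
    (\<forall>a b. \<rho> (a * b) = \<rho> a * \<rho> b)"

lemma is_module_iff: "is_module U \<longleftrightarrow> matrix_rep (vdim U) (act U)"
  by (simp add: is_module_def matrix_rep_def)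

lemma matrix_repD:
  assumes "matrix_rep n \<rho>"
  shows "\<rho> a \<in> carrier_mat n n" "\<rho> (a + b) = \<rho> a + \<rho> b" "\<rho> (c *\<^sub>C a) = c \<cdot>\<^sub>m \<rho> a"
    "\<rho> 1 = 1\<^sub>m n" "\<rho> (a * b) = \<rho> a * \<rho> b"
  using assms by (auto simp: matrix_rep_def)

lemma zero_smult_mat: "(0::'a::semiring_0) \<cdot>\<^sub>m A = 0\<^sub>m (dim_row A) (dim_col A)"
  by (rule eq_matI) auto

lemma matrix_rep_uminus:
  assumes "matrix_rep n \<rho>" shows "\<rho> (- a) = - \<rho> a"
proof -
  have "- a = (- 1) *\<^sub>C a" by (simp add: scaleC_minus_left scaleC_one)
  also have "\<rho> \<dots> = - \<rho> a"
    using matrix_repD(1)[OF assms, of a] by (auto simp: matrix_repD(3)[OF assms])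
  finally show ?thesis .
qed

lemma matrix_rep_diff:
  assumes "matrix_rep n \<rho>" shows "\<rho> (a - b) = \<rho> a - \<rho> b"
  using matrix_repD(2)[OF assms, of a "- b"] matrix_repD(1)[OF assms, of a]
    matrix_repD(1)[OF assms, of b]
  by (auto simp: matrix_rep_uminus[OF assms])

context
  fixes n m and \<rho> :: "'a::complex_algebra \<Rightarrow> complex mat" and \<sigma> :: "'b::complex_algebra \<Rightarrow> complex mat"
  assumes rho: "matrix_rep n \<rho>" and sigma: "matrix_rep m \<sigma>"
begin

lemma tensor_act_pure: "tensor_act n \<rho> m \<sigma> (a \<otimes>\<^sub>C b) = kronecker (\<rho> a) (\<sigma> b)"
proof -
  note R = matrix_repD[OF rho] and S = matrix_repD[OF sigma]
  have D: "dim_row (\<rho> x) = n" "dim_col (\<rho> x) = n" "dim_row (\<sigma> y) = m" "dim_col (\<sigma> y) = m" for x y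
    using R(1)[of x] S(1)[of y] by auto
  \<comment> \<open>\<open>tensor_lift\<close> is 0 on maps that are not bilinear, so bilinearity is
    established entrywise before it can be evaluated.\<close>
  have "bilinear_C (\<lambda>a b. kronecker (\<rho> a) (\<sigma> b) $$ (i, j))" if "i < n * m" "j < n * m" for i j
    using that
    by (auto simp: bilinear_C_def linear_C_def R(2,3) S(2,3) kronecker_index D index_split_bounds
        scaleC_complex_def algebra_simps)
  then show ?thesis
    by (intro eq_matI) (auto simp: tensor_act_def tensor_lift_pure D)
qed

lemma tensor_act_linear:
  "tensor_act n \<rho> m \<sigma> (x + y) = tensor_act n \<rho> m \<sigma> x + tensor_act n \<rho> m \<sigma> y"
  "tensor_act n \<rho> m \<sigma> (c *\<^sub>C x) = c \<cdot>\<^sub>m tensor_act n \<rho> m \<sigma> x"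
  by (rule eq_matI; simp add: tensor_act_def linear_tensor_lift[unfolded linear_C_def]
      scaleC_complex_def)+

lemma tensor_act_carrier: "tensor_act n \<rho> m \<sigma> x \<in> carrier_mat (n * m) (n * m)"
  by (simp add: tensor_act_def)

text \<open>Linearity in each factor reduces multiplicativity to pure tensors, where it is the
  mixed-product rule \<open>kronecker_mult\<close>.\<close>

lemma matrix_rep_tensor_act: "matrix_rep (n * m) (tensor_act n \<rho> m \<sigma>)"
proof -
  note R = matrix_repD[OF rho] and S = matrix_repD[OF sigma]
  note C = tensor_act_carrier
  have one: "tensor_act n \<rho> m \<sigma> 1 = 1\<^sub>m (n * m)"
    by (simp add: one_tensor tensor_act_pure R S kronecker_one)
  have mult: "tensor_act n \<rho> m \<sigma> (x * y) = tensor_act n \<rho> m \<sigma> x * tensor_act n \<rho> m \<sigma> y" for x y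
  proof (induction x rule: tensor_induct)
    case (pure a b)
    show ?case
    proof (induction y rule: tensor_induct)
      case (pure c d)
      show ?case
        by (simp add: pure_tensor_mult tensor_act_pure R S kronecker_mult[OF R(1) S(1) R(1) S(1)])
    next
      case (scale c x)
      then show ?case
        by (simp add: mult_scaleC_right tensor_act_linear mult_smult_distrib[OF C C])
    next
      case (add x y)
      then show ?case
        by (simp add: distrib_left tensor_act_linear mult_add_distrib_mat[OF C C C])
    qed
  next
    case (scale c x)
    then show ?case
      by (simp add: mult_scaleC_left tensor_act_linear mult_smult_assoc_mat[OF C C])
  next
    case (add x y)
    then show ?case
      by (simp add: distrib_right tensor_act_linear add_mult_distrib_mat[OF C C C])
  qed
  show ?thesis
    by (simp add: matrix_rep_def C one mult tensor_act_linear)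
qed

end

text \<open>The intertwining holds for every \<open>x\<close> in the tensor product of the algebras,
  not just for coproducts. Hence the action of any fixed tensor is natural in both modules.\<close>

lemma tensor_act_intertwines:
  assumes rho: "matrix_rep n \<rho>" "matrix_rep n' \<rho>'" and sigma: "matrix_rep m \<sigma>" "matrix_rep m' \<sigma>'"
    and f: "f \<in> carrier_mat n' n" "\<And>a. f * \<rho> a = \<rho>' a * f"
    and g: "g \<in> carrier_mat m' m" "\<And>a. g * \<sigma> a = \<sigma>' a * g"
  shows "tensor_act n' \<rho>' m' \<sigma>' x * kronecker f g = kronecker f g * tensor_act n \<rho> m \<sigma> x"
proof (induction x rule: tensor_induct)
  note R = matrix_repD(1)[OF rho(1)] matrix_repD(1)[OF rho(2)]
  note S = matrix_repD(1)[OF sigma(1)] matrix_repD(1)[OF sigma(2)]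
  note fg = kronecker_carrier[OF f(1) g(1)]
  note C = tensor_act_carrier[OF rho(1) sigma(1)] tensor_act_carrier[OF rho(2) sigma(2)]
  note L = tensor_act_linear[OF rho(1) sigma(1)] tensor_act_linear[OF rho(2) sigma(2)]
  {
    case (pure a b)
    show ?case
      using rho sigma
      by (simp add: tensor_act_pure kronecker_mult[OF R(2) S(2) f(1) g(1)]
          kronecker_mult[OF f(1) g(1) R(1) S(1)] f(2) g(2))
  next
    case (scale c x)
    then show ?case
      by (simp add: L mult_smult_distrib[OF fg C(1)] mult_smult_assoc_mat[OF C(2) fg])
  next
    case (add x y)
    then show ?case
      by (simp add: L mult_add_distrib_mat[OF fg C(1) C(1)] add_mult_distrib_mat[OF C(2) C(2) fg])
  }
qed

lemma tensor_act_assoc: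
  assumes "matrix_rep n \<rho>" "matrix_rep m \<sigma>" "matrix_rep p \<tau>"
  shows "tensor_act (n * m) (tensor_act n \<rho> m \<sigma>) p \<tau> (tensor_assoc x) =
    tensor_act n \<rho> (m * p) (tensor_act m \<sigma> p \<tau>) x"
proof (induction x rule: tensor_induct)
  note rep = matrix_rep_tensor_act[OF assms(1,2)] matrix_rep_tensor_act[OF assms(2,3)]
  note L = tensor_act_linear[OF rep(1) assms(3)] tensor_act_linear[OF assms(1) rep(2)]
    tensor_assoc_linear
  {
    case (pure a y)
    show ?case
    proof (induction y rule: tensor_induct)
      case (pure b c)
      show ?case
        by (simp add: tensor_assoc_pure tensor_act_pure[OF rep(1) assms(3)]
            tensor_act_pure[OF assms(1) rep(2)] tensor_act_pure[OF assms(1,2)]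
            tensor_act_pure[OF assms(2,3)] kronecker_assoc)
    qed (simp_all add: pure_tensor_simps L)
  next
    case (scale c x)
    then show ?case by (simp add: L)
  next
    case (add x y)
    then show ?case by (simp add: L)
  }
qed


subsection \<open>Modules over Q\<close>

lemma qKinv_eq: "qKinv = qK * qK * qK"
  using q_relations_hold(1,8) by (metis mult.assoc mult_1_left mult_1_right)

text \<open>Elements of \<open>Q\<close> are classes of linear combinations of words. Since K^4 = 1,
  the inverse of K is K^3 and needs no case of its own.\<close>

lemma Q_induct [case_names one E F K add scale mult]:
  assumes "P 1" "P qE" "P qF" "P qK"
    and add: "\<And>a b. P a \<Longrightarrow> P b \<Longrightarrow> P (a + b)" and scale: "\<And>c a. P a \<Longrightarrow> P (c *\<^sub>C a)"
    and mult: "\<And>a b. P a \<Longrightarrow> P b \<Longrightarrow> P (a * b)"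
  shows "P (a :: Q)"
proof (induction a rule: Q.abs_induct)
  fix x :: free_algebra
  have gen: "P (abs_Q (free_gen g))" for g
    by (cases g) (use assms qKinv_eq in \<open>simp_all flip: q_gen.abs_eq\<close>)
  show "P (abs_Q x)"
  proof (induction x rule: formal_induct)
    case zero
    show ?case using scale[OF \<open>P 1\<close>, of 0] by (simp add: scaleC_zero_left flip: zero_Q.abs_eq)
  next
    case (single k c)
    obtain w where k: "k = Word w" by (cases k)
    have "P (abs_Q (Poly_Mapping.single (Word w) 1))"
    proof (induction w)
      case Nil
      show ?case using \<open>P 1\<close> by (simp add: one_Q.abs_eq zero_word_def flip: single_one)
    next
      case (Cons g w)
      have "abs_Q (Poly_Mapping.single (Word (g # w)) 1) =
          abs_Q (free_gen g) * abs_Q (Poly_Mapping.single (Word w) 1)"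
        by (simp add: times_Q.abs_eq free_gen_def mult_single)
      then show ?case using mult[OF gen Cons] by simp
    qed
    moreover have "abs_Q (Poly_Mapping.single k c) = c *\<^sub>C abs_Q (Poly_Mapping.single (Word w) 1)"
      by (simp add: scaleC_Q.abs_eq mult_single k)
    ultimately show ?case using scale by simp
  next
    case (add x y)
    then show ?case using assms(5) by (simp flip: plus_Q.abs_eq)
  qed
qed

section \<open>Tensor products of modules and their homomorphisms\<close>

lemma matrix_rep_act2: "is_module U \<Longrightarrow> is_module V \<Longrightarrow> matrix_rep (vdim U * vdim V) (act2 U V)"
  unfolding is_module_iff act2_def by (rule matrix_rep_tensor_act)

lemma matrix_rep_act3:
  "is_module U \<Longrightarrow> is_module V \<Longrightarrow> is_module W \<Longrightarrow>
    matrix_rep (vdim U * vdim V * vdim W) (act3 U V W)"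
  unfolding act3_def is_module_iff[of W] by (intro matrix_rep_tensor_act matrix_rep_act2)

lemma act2_pure:
  "is_module U \<Longrightarrow> is_module V \<Longrightarrow> act2 U V (a \<otimes>\<^sub>C b) = kronecker (act U a) (act V b)"
  unfolding is_module_iff act2_def by (rule tensor_act_pure)

lemma act3_pure:
  "is_module U \<Longrightarrow> is_module V \<Longrightarrow> is_module W \<Longrightarrow>
    act3 U V W (x \<otimes>\<^sub>C c) = kronecker (act2 U V x) (act W c)"
  unfolding act3_def is_module_iff[of W] by (intro tensor_act_pure matrix_rep_act2)

lemma is_module_tensor [intro]:
  assumes "is_module U" "is_module V" shows "is_module (U \<otimes>\<^sub>Q V)"
  using matrix_rep_act2[OF assms]
  by (simp add: is_module_iff module_tensor_def matrix_rep_def coproduct_simps)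

lemma vdim_module_tensor [simp]: "vdim (U \<otimes>\<^sub>Q V) = vdim U * vdim V"
  by (simp add: module_tensor_def)

lemma act_module_tensor:
  assumes "is_module U" "is_module V"
  shows "act (U \<otimes>\<^sub>Q V) qE = kronecker (1\<^sub>m (vdim U)) (act V qE) + kronecker (act U qE) (act V qK)"
    and "act (U \<otimes>\<^sub>Q V) qF = kronecker (act U qKinv) (act V qF) + kronecker (act U qF) (1\<^sub>m (vdim V))"
    and "act (U \<otimes>\<^sub>Q V) qK = kronecker (act U qK) (act V qK)"
  using assms matrix_repD(2)[OF matrix_rep_act2[OF assms]] matrix_repD(4)[of "vdim U" "act U"]
    matrix_repD(4)[of "vdim V" "act V"]
  by (simp_all add: module_tensor_def coproduct_simps act2_pure is_module_iff)

lemma is_module_unit [intro]: "is_module unit_module"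
  by (auto simp: is_module_def unit_module_def counit_simps add_smult_distrib_right_mat
      intro!: eq_matI)

text \<open>The elements of \<open>Q\<close> whose actions are intertwined by \<open>f\<close> form
  a subalgebra, so it is enough that this subalgebra contains E, F and K.\<close>

lemma module_hom_gens:
  assumes U: "is_module U" and V: "is_module V" and f: "f \<in> carrier_mat (vdim V) (vdim U)"
    and gens: "f * act U qE = act V qE * f" "f * act U qF = act V qF * f" "f * act U qK = act V qK * f"
  shows "f \<in> module_hom U V"
proof -
  note RU = matrix_repD[OF U[unfolded is_module_iff]] and RV = matrix_repD[OF V[unfolded is_module_iff]]
  have "f * act U a = act V a * f" for a
  proof (induction a rule: Q_induct)
    case (add a b)
    then show ?case
      by (simp add: RU(2) RV(2) mult_add_distrib_mat[OF f RU(1) RU(1)]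
          add_mult_distrib_mat[OF RV(1) RV(1) f])
  next
    case (scale c a)
    then show ?case
      by (simp add: RU(3) RV(3) mult_smult_distrib[OF f RU(1)] mult_smult_assoc_mat[OF RV(1) f])
  next
    case (mult a b)
    have "f * act U (a * b) = act V a * f * act U b"
      by (simp add: RU(5) mult(1) flip: assoc_mult_mat[OF f RU(1) RU(1)])
    also have "\<dots> = act V (a * b) * f"
      by (simp add: RV(5) mult(2) assoc_mult_mat[OF RV(1) f RU(1)] assoc_mult_mat[OF RV(1) RV(1) f])
    finally show ?case .
  qed (use gens f RU(4) RV(4) in auto)
  then show ?thesis using f by (simp add: module_hom_def)
qed

text \<open>Gives literal equality of modules, not just isomorphism, so that arguments of
  \<open>J\<close> can be rewritten. The identity matrix is a homomorphism because it is one on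
  generators.\<close>

lemma module_eqI:
  assumes "is_module U" "is_module V" "vdim U = vdim V"
    and "act U qE = act V qE" "act U qF = act V qF" "act U qK = act V qK"
  shows "U = V"
proof -
  have C: "act U a \<in> carrier_mat (vdim V) (vdim V)" "act V a \<in> carrier_mat (vdim V) (vdim V)" for a
    using assms(1-3) by (auto simp: is_module_def)
  have "1\<^sub>m (vdim V) \<in> module_hom U V"
    by (rule module_hom_gens)
      (use assms in \<open>simp_all add: left_mult_one_mat[OF C(2)] right_mult_one_mat[OF C(2)]\<close>)
  then have "act U a = act V a" for a
    by (simp add: module_hom_def left_mult_one_mat[OF C(1)] right_mult_one_mat[OF C(2)])
  then show ?thesis using assms(3) by (auto intro: prod_eqI)
qed


subsection \<open>Twists give monoidal structures\<close>

lemma coproduct_map_linear: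
  "coproduct_id (x + y) = coproduct_id x + coproduct_id y" "coproduct_id (c *\<^sub>C x) = c *\<^sub>C coproduct_id x"
  "id_coproduct (x + y) = id_coproduct x + id_coproduct y" "id_coproduct (c *\<^sub>C x) = c *\<^sub>C id_coproduct x"
  "counit_id (x + y) = counit_id x + counit_id y" "counit_id (c *\<^sub>C x) = c *\<^sub>C counit_id x"
  "id_counit (x + y) = id_counit x + id_counit y" "id_counit (c *\<^sub>C x) = c *\<^sub>C id_counit x"
  by (simp_all add: coproduct_id_def id_coproduct_def counit_id_def id_counit_def map_tensor_def
      linear_tensor_lift[unfolded linear_C_def] tensor_assoc_linear)

lemma act3_tensor_assoc:
  assumes "is_module U" "is_module V" "is_module W"
  shows "act3 U V W (tensor_assoc (a \<otimes>\<^sub>C x)) = kronecker (act U a) (act2 V W x)"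
proof -
  note rep = assms[unfolded is_module_iff]
  show ?thesis
    using tensor_act_assoc[OF rep, of "a \<otimes>\<^sub>C x"]
      tensor_act_pure[OF rep(1) matrix_rep_act2[OF assms(2,3)], of a x]
    by (simp add: act3_def act2_def)
qed

text \<open>The action on \<open>U \<otimes>\<^sub>Q V\<close> is by definition \<open>act2\<close>
  after \<open>\<Delta>\<close>, so both sides agree on pure tensors. The same argument in the other
  two slots gives \<open>act3_id_coproduct\<close>.\<close>

lemma act3_coproduct_id:
  assumes "is_module U" "is_module V" "is_module W"
  shows "act3 U V W (coproduct_id x) = act2 (U \<otimes>\<^sub>Q V) W x"
proof -
  note UV = is_module_tensor[OF assms(1,2)]
  note L = matrix_repD(2,3)[OF matrix_rep_act3[OF assms]] matrix_repD(2,3)[OF matrix_rep_act2[OF UV assms(3)]]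
  show ?thesis
  proof (induction x rule: tensor_induct)
    case (pure a b)
    show ?case
      by (simp add: coproduct_counit_pure act3_pure[OF assms] act2_pure[OF UV assms(3)])
         (simp add: module_tensor_def)
  qed (simp_all add: coproduct_map_linear L)
qed

lemma act3_id_coproduct:
  assumes "is_module U" "is_module V" "is_module W"
  shows "act3 U V W (id_coproduct x) = act2 U (V \<otimes>\<^sub>Q W) x"
proof -
  note VW = is_module_tensor[OF assms(2,3)]
  note L = matrix_repD(2,3)[OF matrix_rep_act3[OF assms]] matrix_repD(2,3)[OF matrix_rep_act2[OF assms(1) VW]]
  show ?thesis
  proof (induction x rule: tensor_induct)
    case (pure a b)
    show ?case
      by (simp add: coproduct_counit_pure act3_tensor_assoc[OF assms] act2_pure[OF assms(1) VW])
         (simp add: module_tensor_def)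
  qed (simp_all add: coproduct_map_linear L)
qed

lemma act2_unit_module:
  assumes "is_module U"
  shows "act2 unit_module U x = act U (counit_id x)" "act2 U unit_module x = act U (id_counit x)"
proof -
  note L = matrix_repD(2,3)[OF matrix_rep_act2[OF is_module_unit assms]]
    matrix_repD(2,3)[OF matrix_rep_act2[OF assms is_module_unit]]
    matrix_repD(2,3)[OF assms[unfolded is_module_iff]]
  show "act2 unit_module U x = act U (counit_id x)"
  proof (induction x rule: tensor_induct)
    case (pure a b)
    show ?case
      by (simp add: act2_pure[OF is_module_unit assms] coproduct_counit_pure L)
         (simp add: unit_module_def kronecker_smult kronecker_one_dim[unfolded One_nat_def])
  qed (simp_all add: coproduct_map_linear L)
  show "act2 U unit_module x = act U (id_counit x)"
  proof (induction x rule: tensor_induct)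
    case (pure a b)
    show ?case
      by (simp add: act2_pure[OF assms is_module_unit] coproduct_counit_pure L)
         (simp add: unit_module_def kronecker_smult kronecker_one_dim[unfolded One_nat_def])
  qed (simp_all add: coproduct_map_linear L)
qed

text \<open>Commutation with coproducts makes the components homomorphisms, the counit conditions
  give the unit axioms, and naturality holds for the action of any tensor. The formula for
  \<open>\<Phi>\<close> gives the associativity condition once its factors are reordered.\<close>

lemma monoidal_identity_of_twist:
  assumes inv: "\<F> * \<F>' = 1" "\<F>' * \<F> = 1" and unit: "counit_id \<F> = 1" "id_counit \<F> = 1"
    and comm: "\<And>a. \<F> * \<Delta> a = \<Delta> a * \<F>"
    and Phi: "\<Phi> = (\<F> \<otimes>\<^sub>C 1) * coproduct_id \<F> * id_coproduct \<F>' * tensor_assoc (1 \<otimes>\<^sub>C \<F>')"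
  shows "monoidal_identity \<Phi> (\<lambda>U V. act2 U V \<F>) (1\<^sub>m 1)"
  unfolding monoidal_identity_def
proof (intro conjI allI impI ballI)
  fix U V assume UV: "is_module U" "is_module V"
  note R = matrix_repD[OF matrix_rep_act2[OF UV]]
  have "act2 U V \<F> * act2 U V \<F>' = 1\<^sub>m (vdim U * vdim V)"
    "act2 U V \<F>' * act2 U V \<F> = 1\<^sub>m (vdim U * vdim V)"
    by (simp_all add: inv R(4) flip: R(5))
  then show "invertible_mat (act2 U V \<F>)"
    using R(1)[of \<F>] R(1)[of \<F>'] by (auto simp: invertible_mat_def inverts_mat_def)
  show "act2 U V \<F> \<in> module_hom (U \<otimes>\<^sub>Q V) (U \<otimes>\<^sub>Q V)"
    using R(1)[of \<F>] by (simp add: module_hom_def module_tensor_def comm flip: R(5))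
next
  fix U U' V V' f g
  assume "is_module U" "is_module U'" "is_module V" "is_module V'"
    and "f \<in> module_hom U U'" "g \<in> module_hom V V'"
  then show "act2 U' V' \<F> * kronecker f g = kronecker f g * act2 U V \<F>"
    unfolding act2_def is_module_iff module_hom_def by (intro tensor_act_intertwines) auto
next
  show "1\<^sub>m 1 \<in> module_hom unit_module unit_module"
    by (auto simp: module_hom_def unit_module_def)
  show "invertible_mat (1\<^sub>m 1 :: complex mat)"
    by (auto simp: invertible_mat_def inverts_mat_def intro!: exI[of _ "1\<^sub>m 1"])
next
  fix U assume U: "is_module U"
  have "kronecker (1\<^sub>m 1) (1\<^sub>m (vdim U)) = (1\<^sub>m (vdim U) :: complex mat)"
    "kronecker (1\<^sub>m (vdim U)) (1\<^sub>m 1) = (1\<^sub>m (vdim U) :: complex mat)"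
    by (simp_all add: kronecker_one)
  then show "act2 unit_module U \<F> * kronecker (1\<^sub>m 1) (1\<^sub>m (vdim U)) = 1\<^sub>m (vdim U)"
    "act2 U unit_module \<F> * kronecker (1\<^sub>m (vdim U)) (1\<^sub>m 1) = 1\<^sub>m (vdim U)"
    using matrix_repD(4)[OF U[unfolded is_module_iff]]
    by (simp_all add: act2_unit_module[OF U] unit)
next
  fix U V W assume M: "is_module U" "is_module V" "is_module W"
  let ?n = "vdim U * vdim V * vdim W"
  note UV = is_module_tensor[OF M(1,2)] and VW = is_module_tensor[OF M(2,3)]
  note rep = M[unfolded is_module_iff] UV[unfolded is_module_iff] VW[unfolded is_module_iff]
  note R3 = matrix_repD[OF matrix_rep_act3[OF M]]
  let ?A = "kronecker (act2 U V \<F>) (1\<^sub>m (vdim W))" and ?C = "act2 (U \<otimes>\<^sub>Q V) W \<F>"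
  let ?D = "act2 U (V \<otimes>\<^sub>Q W) \<F>" and ?D' = "act2 U (V \<otimes>\<^sub>Q W) \<F>'"
  let ?P = "kronecker (1\<^sub>m (vdim U)) (act2 V W \<F>)" and ?P' = "kronecker (1\<^sub>m (vdim U)) (act2 V W \<F>')"
  have A: "?A = act3 U V W (\<F> \<otimes>\<^sub>C 1)" by (simp add: act3_pure[OF M] matrix_repD(4)[OF rep(3)])
  have P: "?P = act3 U V W (tensor_assoc (1 \<otimes>\<^sub>C \<F>))" "?P' = act3 U V W (tensor_assoc (1 \<otimes>\<^sub>C \<F>'))"
    by (simp_all add: act3_tensor_assoc[OF M] matrix_repD(4)[OF rep(1)])
  have C: "?C = act3 U V W (coproduct_id \<F>)" by (simp add: act3_coproduct_id[OF M])
  have D: "?D = act3 U V W (id_coproduct \<F>)" "?D' = act3 U V W (id_coproduct \<F>')"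
    by (simp_all add: act3_id_coproduct[OF M])
  have car: "?A \<in> carrier_mat ?n ?n" "?P \<in> carrier_mat ?n ?n" "?P' \<in> carrier_mat ?n ?n"
    "?C \<in> carrier_mat ?n ?n" "?D \<in> carrier_mat ?n ?n" "?D' \<in> carrier_mat ?n ?n"
    unfolding A P C D by (rule R3(1))+
  have F_hom: "act2 U V \<F> * act (U \<otimes>\<^sub>Q V) a = act (U \<otimes>\<^sub>Q V) a * act2 U V \<F>"
    if "is_module U" "is_module V" for U V a
    by (simp add: module_tensor_def comm flip: matrix_repD(5)[OF matrix_rep_act2[OF that]])
  \<comment> \<open>\<open>\<F>\<close> acts on \<open>U \<otimes>\<^sub>Q V\<close> by a module
    homomorphism, so naturality of the action of \<open>\<F>\<close> in its first argument lets the
    two factors commute. The next swap uses the second argument.\<close>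
  have "?C * ?A = ?A * ?C"
    unfolding act2_def[of "U \<otimes>\<^sub>Q V"]
    using matrix_repD(1)[OF matrix_rep_act2[OF M(1,2)], of \<F>] F_hom[OF M(1,2)]
      left_mult_one_mat[OF matrix_repD(1)[OF rep(3)]] right_mult_one_mat[OF matrix_repD(1)[OF rep(3)]]
    by (intro tensor_act_intertwines rep) auto
  moreover have "?D * ?P = ?P * ?D"
    unfolding act2_def[of _ "V \<otimes>\<^sub>Q W"]
    using matrix_repD(1)[OF matrix_rep_act2[OF M(2,3)], of \<F>] F_hom[OF M(2,3)]
      left_mult_one_mat[OF matrix_repD(1)[OF rep(1)]] right_mult_one_mat[OF matrix_repD(1)[OF rep(1)]]
    by (intro tensor_act_intertwines rep) auto
  moreover have "?P' * ?P = 1\<^sub>m ?n"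
  proof -
    note R = matrix_repD[OF matrix_rep_act2[OF M(2,3)]]
    have "?P' * ?P = kronecker (1\<^sub>m (vdim U)) (act2 V W (\<F>' * \<F>))"
      by (simp add: kronecker_mult[OF one_carrier_mat R(1) one_carrier_mat R(1)] R(5))
    then show ?thesis by (simp add: inv R(4) kronecker_one mult.assoc)
  qed
  moreover have "?D' * ?D = 1\<^sub>m ?n"
    using matrix_repD(4)[OF matrix_rep_act2[OF M(1) VW]]
    by (simp add: inv mult.assoc flip: matrix_repD(5)[OF matrix_rep_act2[OF M(1) VW]])
  moreover have "act3 U V W \<Phi> = ?A * ?C * ?D' * ?P'"
    unfolding A P C D Phi R3(5) by simp
  \<comment> \<open>With \<open>?D * ?P\<close> swapped, the inverse factors meet and cancel from
    the inside out. Products are reassociated as images under \<open>act3\<close>, where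
    associativity of the algebra carries no dimension conditions.\<close>
  ultimately have "act3 U V W \<Phi> * ?D * ?P = ?A * ?C * ?D' * ?P' * (?P * ?D)"
    by (metis A C D P R3(5) mult.assoc)
  also have "\<dots> = ?A * ?C * ?D' * (?P' * ?P) * ?D"
    unfolding A P C D by (simp only: mult.assoc flip: R3(5))
  also have "\<dots> = ?A * ?C * (?D' * ?D)"
    unfolding \<open>?P' * ?P = _\<close> A C D
    by (simp only: right_mult_one_mat[OF R3(1)] mult.assoc[where 'a = "((Q, Q) tensor, Q) tensor"] flip: R3(5))
  also have "\<dots> = ?A * ?C"
    unfolding \<open>?D' * ?D = _\<close> A C by (simp only: right_mult_one_mat[OF R3(1)] flip: R3(5))
  finally show "act3 U V W \<Phi> * ?D * ?P = ?C * ?A"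
    unfolding \<open>?C * ?A = _\<close> .
qed


subsection \<open>The sign module and the spin module\<close>

text \<open>If E and F act by 0, the commutator relation forces K to equal its inverse, so a
  character has K = 1 or K = -1. The value 1 is the counit; this is the other one.\<close>

fun sign_gen :: "q_generator \<Rightarrow> complex" where
  "sign_gen Gen_E = 0"
| "sign_gen Gen_F = 0"
| "sign_gen Gen_K = - 1"
| "sign_gen Gen_Kinv = - 1"

lift_definition sign_char :: "Q \<Rightarrow> complex" is "free_hom sign_gen"
proof (rule free_hom_q_eq)
  fix r assume "r \<in> q_relations"
  then show "free_hom sign_gen r = 0"
    by (auto simp: q_relations_def Let_def free_hom_simps scaleC_complex_def)
qed

lemma sign_char_simps:
  "sign_char (x + y) = sign_char x + sign_char y" "sign_char (c *\<^sub>C x) = c * sign_char x"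
  "sign_char (x * y) = sign_char x * sign_char y" "sign_char 1 = 1"
  "sign_char qE = 0" "sign_char qF = 0" "sign_char qK = - 1"
proof -
  show "sign_char (x + y) = sign_char x + sign_char y" "sign_char (x * y) = sign_char x * sign_char y"
    by (induction x rule: Q.abs_induct, induction y rule: Q.abs_induct,
        simp add: sign_char.abs_eq plus_Q.abs_eq times_Q.abs_eq free_hom_simps)+
  show "sign_char (c *\<^sub>C x) = c * sign_char x"
    by (induction x rule: Q.abs_induct)
      (simp add: sign_char.abs_eq scaleC_Q.abs_eq free_hom_simps scaleC_complex_def)
qed (simp_all add: one_Q_def q_gen.abs_eq sign_char.abs_eq free_hom_simps)

definition sign_module :: q_module
  where "sign_module = (1, \<lambda>a. sign_char a \<cdot>\<^sub>m 1\<^sub>m 1)"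

lemma is_module_sign [intro]: "is_module sign_module"
  by (auto simp: is_module_def sign_module_def sign_char_simps add_smult_distrib_right_mat
      intro!: eq_matI)

text \<open>\<open>complex mat\<close> contains matrices of all sizes and is therefore not an instance of \<open>complex_algebra\<close>.\<close>

datatype mat2 = Mat2 (m11: complex) (m12: complex) (m21: complex) (m22: complex)

instantiation mat2 :: complex_algebra
begin
definition "0 = Mat2 0 0 0 0"
definition "1 = Mat2 1 0 0 1"
definition "x + y = Mat2 (m11 x + m11 y) (m12 x + m12 y) (m21 x + m21 y) (m22 x + m22 y)"
definition "x - y = Mat2 (m11 x - m11 y) (m12 x - m12 y) (m21 x - m21 y) (m22 x - m22 y)"
definition "- x = Mat2 (- m11 x) (- m12 x) (- m21 x) (- m22 x)"
definition "x * y = Mat2 (m11 x * m11 y + m12 x * m21 y) (m11 x * m12 y + m12 x * m22 y)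
  (m21 x * m11 y + m22 x * m21 y) (m21 x * m12 y + m22 x * m22 y)"
definition "c *\<^sub>C x = Mat2 (c * m11 x) (c * m12 x) (c * m21 x) (c * m22 x)"
instance
  by intro_classes
    (simp_all add: zero_mat2_def one_mat2_def plus_mat2_def minus_mat2_def uminus_mat2_def
      times_mat2_def scaleC_mat2_def mat2.expand algebra_simps)
end

lemmas mat2_defs = zero_mat2_def one_mat2_def plus_mat2_def minus_mat2_def uminus_mat2_def
  times_mat2_def scaleC_mat2_def

definition mat_of_mat2 :: "mat2 \<Rightarrow> complex mat"
  where "mat_of_mat2 x = mat 2 2 (\<lambda>(i, j).
    if i = 0 then if j = 0 then m11 x else m12 x else if j = 0 then m21 x else m22 x)"

lemma mat_of_mat2_carrier [simp]: "mat_of_mat2 x \<in> carrier_mat 2 2"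
  by (simp add: mat_of_mat2_def)

lemma mat_of_mat2_dim [simp]: "dim_row (mat_of_mat2 x) = 2" "dim_col (mat_of_mat2 x) = 2"
  by (simp_all add: mat_of_mat2_def)

lemma mat_of_mat2_index:
  "mat_of_mat2 x $$ (0, 0) = m11 x" "mat_of_mat2 x $$ (0, 1) = m12 x"
  "mat_of_mat2 x $$ (1, 0) = m21 x" "mat_of_mat2 x $$ (1, 1) = m22 x"
  by (simp_all add: mat_of_mat2_def)

lemma eq_mat2I:
  assumes "A \<in> carrier_mat 2 2" "B \<in> carrier_mat 2 2"
    and "A $$ (0, 0) = B $$ (0, 0)" "A $$ (0, 1) = B $$ (0, 1)"
    and "A $$ (1, 0) = B $$ (1, 0)" "A $$ (1, 1) = B $$ (1, 1)"
  shows "A = B"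
proof (rule eq_matI)
  fix i j assume "i < dim_row B" "j < dim_col B"
  then have "i = 0 \<or> i = 1" "j = 0 \<or> j = 1" using assms(2) by auto
  then show "A $$ (i, j) = B $$ (i, j)" using assms(3-6) by auto
qed (use assms in auto)

lemma mat2_times_index:
  assumes "A \<in> carrier_mat 2 2" "B \<in> carrier_mat 2 2" "i < 2" "j < 2"
  shows "(A * B) $$ (i, j) = A $$ (i, 0) * B $$ (0, j) + A $$ (i, 1) * B $$ (1, j)"
  using assms by (simp add: scalar_prod_def numeral_2_eq_2)

lemma mat_of_mat2_hom:
  "mat_of_mat2 (x + y) = mat_of_mat2 x + mat_of_mat2 y"
  "mat_of_mat2 (c *\<^sub>C x) = c \<cdot>\<^sub>m mat_of_mat2 x"
  "mat_of_mat2 (x * y) = mat_of_mat2 x * mat_of_mat2 y"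
  "mat_of_mat2 1 = 1\<^sub>m 2" "mat_of_mat2 0 = 0\<^sub>m 2 2" "mat_of_mat2 (- x) = - mat_of_mat2 x"
  by (rule eq_mat2I;
      simp add: mat2_times_index mat_of_mat2_index[unfolded One_nat_def] mat2_defs
        mult_carrier_mat[OF mat_of_mat2_carrier mat_of_mat2_carrier]
        del: index_mult_mat(1))+

section \<open>The spin module\<close>

definition "spin_E = Mat2 0 1 0 0"
definition "spin_F = Mat2 0 0 1 0"
definition "spin_K = Mat2 \<i> 0 0 (- \<i>)"

lemmas spin_defs = spin_E_def spin_F_def spin_K_def

text \<open>The square of \<open>spin_K\<close> is -1, so its inverse is \<open>- spin_K\<close>,
  and (K - K^-1)/(2\<i>) becomes diag(1, -1), the commutator of \<open>spin_E\<close> and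
  \<open>spin_F\<close>.\<close>

fun spin_gen :: "q_generator \<Rightarrow> mat2" where
  "spin_gen Gen_E = spin_E"
| "spin_gen Gen_F = spin_F"
| "spin_gen Gen_K = spin_K"
| "spin_gen Gen_Kinv = - spin_K"

lift_definition spin_rep :: "Q \<Rightarrow> mat2" is "free_hom spin_gen"
proof (rule free_hom_q_eq)
  fix r assume "r \<in> q_relations"
  then show "free_hom spin_gen r = 0"
    unfolding q_relations_def Let_def
    by (elim insertE emptyE)
      (simp_all add: free_hom_simps power_numeral_reduce mat2_defs spin_defs)
qed

lemma spin_rep_simps:
  "spin_rep (x + y) = spin_rep x + spin_rep y" "spin_rep (c *\<^sub>C x) = c *\<^sub>C spin_rep x"
  "spin_rep (x * y) = spin_rep x * spin_rep y" "spin_rep 1 = 1"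
  "spin_rep qE = spin_E" "spin_rep qF = spin_F" "spin_rep qK = spin_K"
proof -
  show "spin_rep (x + y) = spin_rep x + spin_rep y" "spin_rep (x * y) = spin_rep x * spin_rep y"
    by (induction x rule: Q.abs_induct, induction y rule: Q.abs_induct,
        simp add: spin_rep.abs_eq plus_Q.abs_eq times_Q.abs_eq free_hom_simps)+
  show "spin_rep (c *\<^sub>C x) = c *\<^sub>C spin_rep x"
    by (induction x rule: Q.abs_induct)
      (simp add: spin_rep.abs_eq scaleC_Q.abs_eq free_hom_simps mult_scaleC_left)
qed (simp_all add: one_Q_def q_gen.abs_eq spin_rep.abs_eq free_hom_simps)

definition spin_module :: q_module
  where "spin_module = (2, \<lambda>a. mat_of_mat2 (spin_rep a))"

lemma is_module_spin [intro]: "is_module spin_module"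
  by (simp add: is_module_def spin_module_def spin_rep_simps mat_of_mat2_hom)

lemma vdim_modules [simp]:
  "vdim sign_module = 1" "vdim spin_module = 2" "vdim unit_module = 1"
  by (simp_all add: sign_module_def spin_module_def unit_module_def)

lemma act_sign: "act sign_module a = sign_char a \<cdot>\<^sub>m 1\<^sub>m 1"
  by (simp add: sign_module_def)

lemma act_spin: "act spin_module a = mat_of_mat2 (spin_rep a)"
  by (simp add: spin_module_def)

section \<open>Tensor products of the sign and spin modules\<close>

lemma kronecker_scalar:
  "kronecker (c \<cdot>\<^sub>m 1\<^sub>m 1) A = c \<cdot>\<^sub>m A" "kronecker A (c \<cdot>\<^sub>m 1\<^sub>m 1) = c \<cdot>\<^sub>m A"
  by (simp_all only: kronecker_smult kronecker_one_dim)

lemma sign_tensor_sign: "sign_module \<otimes>\<^sub>Q sign_module = unit_module"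
proof (rule module_eqI)
  show "is_module (sign_module \<otimes>\<^sub>Q sign_module)" "is_module unit_module" by auto
qed (auto simp: act_module_tensor is_module_sign act_sign unit_module_def qKinv_eq
    sign_char_simps counit_simps kronecker_scalar simp del: One_nat_def intro!: eq_matI)

text \<open>The coproduct puts K to the right of E and the inverse of K to the left of F, so
  tensoring with the sign module on the left negates F, and on the right negates E.\<close>

lemma sign_tensor_spin:
  "act (sign_module \<otimes>\<^sub>Q spin_module) qE = mat_of_mat2 spin_E"
  "act (sign_module \<otimes>\<^sub>Q spin_module) qF = mat_of_mat2 (- spin_F)"
  "act (sign_module \<otimes>\<^sub>Q spin_module) qK = mat_of_mat2 (- spin_K)"
  and spin_tensor_sign:
  "act (spin_module \<otimes>\<^sub>Q sign_module) qE = mat_of_mat2 (- spin_E)"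
  "act (spin_module \<otimes>\<^sub>Q sign_module) qF = mat_of_mat2 spin_F"
  "act (spin_module \<otimes>\<^sub>Q sign_module) qK = mat_of_mat2 (- spin_K)"
  unfolding act_module_tensor[OF is_module_sign is_module_spin]
    act_module_tensor[OF is_module_spin is_module_sign]
  by (auto simp: act_sign act_spin qKinv_eq sign_char_simps spin_rep_simps
      kronecker_scalar kronecker_one_dim mat_of_mat2_hom simp del: One_nat_def intro!: eq_matI)

text \<open>The nonzero factors \<open>c\<close> and \<open>d\<close> absorb the signs by which the
  products with the sign module differ from the spin module.\<close>

lemma schur_spin:
  assumes M: "M \<in> carrier_mat 2 2"
    and "c \<noteq> 0" "M * mat_of_mat2 (c *\<^sub>C spin_E) = mat_of_mat2 (c *\<^sub>C spin_E) * M"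
    and "d \<noteq> 0" "M * mat_of_mat2 (d *\<^sub>C spin_F) = mat_of_mat2 (d *\<^sub>C spin_F) * M"
  obtains m where "M = m \<cdot>\<^sub>m 1\<^sub>m 2"
proof
  let ?E = "mat_of_mat2 (c *\<^sub>C spin_E)" and ?F = "mat_of_mat2 (d *\<^sub>C spin_F)"
  note I = mat2_times_index[OF M mat_of_mat2_carrier] mat2_times_index[OF mat_of_mat2_carrier M]
  have "(M * ?E) $$ (0, 1) = (?E * M) $$ (0, 1)" "(M * ?E) $$ (1, 1) = (?E * M) $$ (1, 1)"
    "(M * ?F) $$ (0, 0) = (?F * M) $$ (0, 0)"
    using assms by simp_all
  then have "M $$ (1, 1) = M $$ (0, 0)" "M $$ (1, 0) = 0" "M $$ (0, 1) = 0"
    using assms(2,4)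
    by (simp_all add: I mat_of_mat2_index mat2_defs spin_defs del: One_nat_def index_mult_mat)
  then show "M = M $$ (0, 0) \<cdot>\<^sub>m 1\<^sub>m 2"
    using M by (intro eq_mat2I) auto
qed

text \<open>The vector \<open>v \<otimes> w + \<i> w \<otimes> v\<close>, for the standard basis \<open>v\<close>, \<open>w\<close> of the spin module.\<close>

definition singlet :: "complex mat"
  where "singlet = mat 4 1 (\<lambda>(i, j). if i = 1 then 1 else if i = 2 then \<i> else 0)"

text \<open>E sends v \<otimes> w to v \<otimes> v and w \<otimes> v to \<i> v \<otimes> v, so the
  coefficient \<i> makes the images cancel; F behaves alike with w \<otimes> w. K acts by \<i>
  (-\<i>) = 1.\<close>

lemma singlet_hom: "singlet \<in> module_hom unit_module (spin_module \<otimes>\<^sub>Q spin_module)"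
proof (rule module_hom_gens)
  have less4: "i < 4 \<longleftrightarrow> i = 0 \<or> i = 1 \<or> i = 2 \<or> i = 3" for i :: nat by auto
  have div: "Suc 0 div 2 = 0" "(2::nat) div 2 = 1" "(3::nat) div 2 = 1"
    "Suc 0 mod 2 = Suc 0" "(2::nat) mod 2 = 0" "(3::nat) mod 2 = 1" by simp_all
  have sum4: "sum f {0..<4} = f 0 + f 1 + f 2 + f 3" for f :: "nat \<Rightarrow> complex"
    by (simp add: eval_nat_numeral)
  note simps = act_module_tensor[OF is_module_spin is_module_spin] act_spin spin_rep_simps qKinv_eq
    unit_module_def counit_simps singlet_def mat2_defs spin_defs kronecker_def mat_of_mat2_def
    scalar_prod_def sum4 less4
  show "singlet * act unit_module qE = act (spin_module \<otimes>\<^sub>Q spin_module) qE * singlet"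
    "singlet * act unit_module qF = act (spin_module \<otimes>\<^sub>Q spin_module) qF * singlet"
    "singlet * act unit_module qK = act (spin_module \<otimes>\<^sub>Q spin_module) qK * singlet"
    by (rule eq_matI; auto simp: simps)+
qed (auto simp: singlet_def)

text \<open>K anticommutes with E and F, which is exactly the sign change of both between the two
  orders of the factors.\<close>

lemma spin_K_hom:
  "mat_of_mat2 spin_K \<in> module_hom (sign_module \<otimes>\<^sub>Q spin_module) (spin_module \<otimes>\<^sub>Q sign_module)"
  by (rule module_hom_gens)
    (auto simp: sign_tensor_spin spin_tensor_sign mat2_defs spin_defs simp flip: mat_of_mat2_hom)


subsection \<open>The action of the coassociator\<close>

lemma sign_char_idempotents: "sign_char e0 = 1" "sign_char e1 = 0"
proof -
  have "sign_char (qK ^ 2) = 1"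
    by (simp add: power2_eq_square sign_char_simps)
  moreover have "sign_char (1 - qK ^ 2) = sign_char 1 - sign_char (qK ^ 2)"
    using sign_char_simps(1)[of "1 - qK ^ 2" "qK ^ 2"] by simp
  ultimately show "sign_char e0 = 1" "sign_char e1 = 0"
    by (simp_all add: e0_def e1_def sign_char_simps)
qed

lemma spin_rep_idempotents: "spin_rep e0 = 0" "spin_rep e1 = 1"
proof -
  have "spin_rep (qK ^ 2) = - 1"
    by (simp add: power2_eq_square spin_rep_simps mat2_defs spin_defs)
  moreover have "spin_rep (1 - qK ^ 2) = spin_rep 1 - spin_rep (qK ^ 2)"
    using spin_rep_simps(1)[of "1 - qK ^ 2" "qK ^ 2"] by simp
  ultimately show "spin_rep e0 = 0" "spin_rep e1 = 1"
    by (simp_all add: e0_def e1_def spin_rep_simps mat2_defs)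
qed

lemma act3_pure3:
  assumes "is_module U" "is_module V" "is_module W"
  shows "act3 U V W (a \<otimes>\<^sub>C b \<otimes>\<^sub>C c) = kronecker (kronecker (act U a) (act V b)) (act W c)"
  using assms by (simp add: act3_pure act2_pure)

text \<open>\<open>e0\<close> is 1 on the sign module and 0 on the spin module, and
  \<open>e1\<close> the reverse, so one of the eight summands survives on each triple. In
  \<open>Phi010\<close> and \<open>Phi101\<close>, every term with E or F in a slot of the sign
  module vanishes. What remains is 1 in the first case and 1 \<otimes> K \<otimes> 1 in the second,
  where K acts by -1.\<close>

lemma act3_coassociator:
  shows "act3 sign_module sign_module spin_module (coassociator \<beta>) = 1\<^sub>m 2"
    and "act3 sign_module spin_module sign_module (coassociator \<beta>) = 1\<^sub>m 2"
    and "act3 spin_module sign_module sign_module (coassociator \<beta>) = 1\<^sub>m 2"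
    and "act3 sign_module spin_module spin_module (coassociator \<beta>) = 1\<^sub>m 4"
    and "act3 spin_module spin_module sign_module (coassociator \<beta>) = 1\<^sub>m 4"
    and "act3 spin_module sign_module spin_module (coassociator \<beta>) = (- 1) \<cdot>\<^sub>m 1\<^sub>m 4"
proof -
  note S = act_sign act_spin sign_char_idempotents spin_rep_idempotents sign_char_simps spin_rep_simps(4)
    mat_of_mat2_hom kronecker_scalar kronecker_one kronecker_smult zero_smult_mat
  have one_smult: "1 \<cdot>\<^sub>m A = A" for A :: "complex mat" by (rule eq_matI) auto
  have minus_zero: "A - 0\<^sub>m n m = A" if "A \<in> carrier_mat n m" for A :: "complex mat" and n m
    using that by (intro eq_matI) auto
  note X = is_module_sign and T = is_module_spin
  {
    note R = matrix_rep_act3[OF X X T]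
    note R = matrix_repD[OF R] matrix_rep_diff[OF R] act3_pure3[OF X X T]
    show "act3 sign_module sign_module spin_module (coassociator \<beta>) = 1\<^sub>m 2"
      \<comment> \<open>The sizes of these blocks are supplied so that their products with zero
        matrices simplify.\<close>
      using R(1)[of Phi010] R(1)[of Phi101] R(1)[of "Phi111 \<beta>"]
      by (simp add: coassociator_def R S one_smult minus_zero del: One_nat_def)
  next
    note R = matrix_rep_act3[OF X T X]
    note R = matrix_repD[OF R] matrix_rep_diff[OF R] act3_pure3[OF X T X]
    show "act3 sign_module spin_module sign_module (coassociator \<beta>) = 1\<^sub>m 2"
      using R(1)[of Phi101] R(1)[of "Phi111 \<beta>"]
      by (simp add: coassociator_def Phi010_def Let_def R S one_smult minus_zero del: One_nat_def)
  next
    note R = matrix_rep_act3[OF T X X]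
    note R = matrix_repD[OF R] matrix_rep_diff[OF R] act3_pure3[OF T X X]
    show "act3 spin_module sign_module sign_module (coassociator \<beta>) = 1\<^sub>m 2"
      using R(1)[of Phi010] R(1)[of Phi101] R(1)[of "Phi111 \<beta>"]
      by (simp add: coassociator_def R S one_smult minus_zero del: One_nat_def)
  next
    note R = matrix_rep_act3[OF X T T]
    note R = matrix_repD[OF R] matrix_rep_diff[OF R] act3_pure3[OF X T T]
    show "act3 sign_module spin_module spin_module (coassociator \<beta>) = 1\<^sub>m 4"
      using R(1)[of Phi010] R(1)[of Phi101] R(1)[of "Phi111 \<beta>"]
      by (simp add: coassociator_def R S one_smult minus_zero del: One_nat_def)
  next
    note R = matrix_rep_act3[OF T T X]
    note R = matrix_repD[OF R] matrix_rep_diff[OF R] act3_pure3[OF T T X]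
    show "act3 spin_module spin_module sign_module (coassociator \<beta>) = 1\<^sub>m 4"
      using R(1)[of Phi010] R(1)[of Phi101] R(1)[of "Phi111 \<beta>"]
      by (simp add: coassociator_def R S one_smult minus_zero del: One_nat_def)
  next
    note R = matrix_rep_act3[OF T X T]
    note R = matrix_repD[OF R] matrix_rep_diff[OF R] act3_pure3[OF T X T]
    show "act3 spin_module sign_module spin_module (coassociator \<beta>) = (- 1) \<cdot>\<^sub>m 1\<^sub>m 4"
      using R(1)[of Phi010] R(1)[of "Phi111 \<beta>"]
      by (simp add: coassociator_def Phi101_def Let_def R S one_smult minus_zero
          del: One_nat_def)
  }
qed


subsection \<open>The obstruction\<close>

lemma smult_one_dim: "A \<in> carrier_mat 1 1 \<Longrightarrow> \<exists>c. A = c \<cdot>\<^sub>m 1\<^sub>m 1" for A :: "complex mat"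
  by (intro exI[of _ "A $$ (0, 0)"] eq_matI) auto

lemma invertible_matE:
  assumes "invertible_mat A" "A \<in> carrier_mat n n"
  obtains B where "B \<in> carrier_mat n n" "A * B = 1\<^sub>m n" "B * A = 1\<^sub>m n"
proof -
  obtain B where B: "A * B = 1\<^sub>m n" "B * A = 1\<^sub>m (dim_row B)"
    using assms by (auto simp: invertible_mat_def inverts_mat_def)
  have "dim_col B = n" using arg_cong[OF B(1), of dim_col] by simp
  moreover have "dim_row B = n" using arg_cong[OF B(2), of dim_col] assms(2) by simp
  ultimately show thesis using that[of B] B by auto
qed

lemma smult_smult_mat: "c \<cdot>\<^sub>m (d \<cdot>\<^sub>m A) = (c * d) \<cdot>\<^sub>m A" for A :: "'a::semigroup_mult mat"
  by (rule eq_matI) (simp_all add: mult.assoc)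

lemma times_smult_one:
  fixes A :: "complex mat"
  assumes "A \<in> carrier_mat n m" shows "A * (c \<cdot>\<^sub>m 1\<^sub>m m) = c \<cdot>\<^sub>m A"
  using mult_smult_distrib[OF assms one_carrier_mat, of c] assms by simp

lemma not_monoidal_identity:
  assumes XXT: "act3 sign_module sign_module spin_module \<Phi> = 1\<^sub>m 2"
    and XTX: "act3 sign_module spin_module sign_module \<Phi> = 1\<^sub>m 2"
    and TXX: "act3 spin_module sign_module sign_module \<Phi> = 1\<^sub>m 2"
    and XTT: "act3 sign_module spin_module spin_module \<Phi> = 1\<^sub>m 4"
    and TTX: "act3 spin_module spin_module sign_module \<Phi> = 1\<^sub>m 4"
    and TXT: "act3 spin_module sign_module spin_module \<Phi> = (- 1) \<cdot>\<^sub>m 1\<^sub>m 4"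
  shows "\<not> monoidal_identity \<Phi> J \<phi>"
proof
  assume mon: "monoidal_identity \<Phi> J \<phi>"
  let ?X = sign_module and ?T = spin_module and ?I = unit_module
  let ?XT = "?X \<otimes>\<^sub>Q ?T" and ?TX = "?T \<otimes>\<^sub>Q ?X" and ?TT = "?T \<otimes>\<^sub>Q ?T"
  let ?\<kappa> = "mat_of_mat2 spin_K"
  note mods = is_module_sign is_module_spin is_module_unit is_module_tensor
  note mon = mon[unfolded monoidal_identity_def]
  note conj1 = mon[THEN conjunct1] and conj2 = mon[THEN conjunct2, THEN conjunct1]
    and mon = mon[THEN conjunct2, THEN conjunct2]
  note conj3 = mon[THEN conjunct1]
    and conj4 = mon[THEN conjunct2, THEN conjunct2, THEN conjunct1]
    and conj5 = mon[THEN conjunct2, THEN conjunct2, THEN conjunct2]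
  have hom: "J U V \<in> module_hom (U \<otimes>\<^sub>Q V) (U \<otimes>\<^sub>Q V)" and inv: "invertible_mat (J U V)"
    if "is_module U" "is_module V" for U V
    using conj1 that by blast+
  have car: "J U V \<in> carrier_mat (vdim U * vdim V) (vdim U * vdim V)"
    and comm: "J U V * act (U \<otimes>\<^sub>Q V) x = act (U \<otimes>\<^sub>Q V) x * J U V"
    if "is_module U" "is_module V" for U V x
    using hom[OF that] by (simp_all add: module_hom_def)
  have nat: "J U' V' * kronecker f g = kronecker f g * J U V"
    if "is_module U" "is_module U'" "is_module V" "is_module V'"
      "f \<in> module_hom U U'" "g \<in> module_hom V V'" for U U' V V' f g
    using conj2 that by blast
  have id: "1\<^sub>m (vdim U) \<in> module_hom U U" if "is_module U" for U
  proof -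
    have "act U x \<in> carrier_mat (vdim U) (vdim U)" for x using that by (simp add: is_module_def)
    note left_mult_one_mat[OF this] right_mult_one_mat[OF this]
    then show ?thesis by (simp add: module_hom_def)
  qed
  have assoc: "act3 U V W \<Phi> * J U (V \<otimes>\<^sub>Q W) * kronecker (1\<^sub>m (vdim U)) (J V W) =
      J (U \<otimes>\<^sub>Q V) W * kronecker (J U V) (1\<^sub>m (vdim W))"
    if "is_module U" "is_module V" "is_module W" for U V W
    using conj4 that by blast
  have units: "J ?I U * kronecker \<phi> (1\<^sub>m (vdim U)) = 1\<^sub>m (vdim U)"
    "J U ?I * kronecker (1\<^sub>m (vdim U)) \<phi> = 1\<^sub>m (vdim U)" if "is_module U" for U
    using conj5 that by blast+
  have "\<phi> \<in> carrier_mat 1 1"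
    using conj3 by (simp add: module_hom_def unit_module_def)
  then obtain p where p: "\<phi> = p \<cdot>\<^sub>m 1\<^sub>m 1" using smult_one_dim by blast
  \<comment> \<open>As \<open>\<phi>\<close> is the scalar \<open>p\<close>, the unit axioms say
    that every component of \<open>J\<close> with a unit argument is the inverse of
    \<open>p\<close>.\<close>
  have unit_left: "p \<cdot>\<^sub>m J ?I U = 1\<^sub>m (vdim U)" and unit_right: "p \<cdot>\<^sub>m J U ?I = 1\<^sub>m (vdim U)"
    if "is_module U" for U
    using units[OF that] times_smult_one[OF car[OF is_module_unit that]]
      times_smult_one[OF car[OF that is_module_unit]]
    by (simp_all add: p kronecker_scalar kronecker_smult kronecker_one)
  note X = is_module_sign and T = is_module_spin and I = is_module_unit
  note XT = is_module_tensor[OF X T] and TX = is_module_tensor[OF T X] and TT = is_module_tensor[OF T T]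
  have car1: "J ?X ?X \<in> carrier_mat 1 1" using car[OF X X] by simp
  then obtain d where d: "J ?X ?X = d \<cdot>\<^sub>m 1\<^sub>m 1"
    using smult_one_dim by blast
  have "d \<noteq> 0"
  proof
    assume "d = 0"
    obtain B where "B \<in> carrier_mat 1 1" "J ?X ?X * B = 1\<^sub>m 1"
      using invertible_matE[OF inv[OF X X] car1] by blast
    moreover have "J ?X ?X = 0\<^sub>m 1 1" using \<open>d = 0\<close> d by (simp add: zero_smult_mat)
    ultimately have "0\<^sub>m 1 1 = (1\<^sub>m 1 :: complex mat)" by simp
    from arg_cong[OF this, of "\<lambda>M. M $$ (0, 0)"] show False by simp
  qed
  \<comment> \<open>The factors 1 and -1 are the signs of E and F on \<open>?XT\<close>; for
    \<open>?TX\<close> below they are exchanged.\<close>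
  obtain a where a: "J ?X ?T = a \<cdot>\<^sub>m 1\<^sub>m 2"
  proof (rule schur_spin[of "J ?X ?T" 1 "- 1"])
    show "J ?X ?T \<in> carrier_mat 2 2" using car[of ?X ?T] mods by simp
  qed (use comm[OF is_module_sign is_module_spin, of qE] comm[OF is_module_sign is_module_spin, of qF] in
      \<open>simp_all add: sign_tensor_spin scaleC_minus_left scaleC_one\<close>)
  obtain b where b: "J ?T ?X = b \<cdot>\<^sub>m 1\<^sub>m 2"
  proof (rule schur_spin[of "J ?T ?X" "- 1" 1])
    show "J ?T ?X \<in> carrier_mat 2 2" using car[of ?T ?X] mods by simp
  qed (use comm[OF is_module_spin is_module_sign, of qE] comm[OF is_module_spin is_module_sign, of qF] in
      \<open>simp_all add: spin_tensor_sign scaleC_minus_left scaleC_one\<close>)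
  note simps = sign_tensor_sign a b d p kronecker_scalar kronecker_smult kronecker_one kronecker_one_dim
  have id_X: "1\<^sub>m 1 \<in> module_hom ?X ?X" and id_T: "1\<^sub>m 2 \<in> module_hom ?T ?T"
    using id[OF X] id[OF T] by simp_all
  have kappa: "?\<kappa> \<in> carrier_mat 2 2" by simp

  have "b * b = a * a"
  proof -
    define M where "M = J ?X ?TX"
    define N where "N = J ?XT ?X"
    have M: "M \<in> carrier_mat 2 2" "N \<in> carrier_mat 2 2"
      "J ?X ?XT \<in> carrier_mat 2 2" "J ?TX ?X \<in> carrier_mat 2 2"
      using car[OF X TX] car[OF XT X] car[OF X XT] car[OF TX X] by (simp_all add: M_def N_def)
    have I2: "J ?I ?T \<in> carrier_mat 2 2" "J ?T ?I \<in> carrier_mat 2 2"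
      using car[OF I T] car[OF T I] by simp_all
    \<comment> \<open>Associativity on XXT, TXX and XTX, with X \<otimes> X replaced by the unit
      module, followed by naturality along \<open>?\<kappa>\<close>.\<close>
    have "a \<cdot>\<^sub>m J ?X ?XT = d \<cdot>\<^sub>m J ?I ?T"
      using assoc[OF X X T] M I2 by (simp add: XXT simps times_smult_one del: One_nat_def)
    moreover have "d \<cdot>\<^sub>m J ?T ?I = b \<cdot>\<^sub>m J ?TX ?X"
      using assoc[OF T X X] M I2 by (simp add: TXX simps times_smult_one del: One_nat_def)
    moreover have "b \<cdot>\<^sub>m M = a \<cdot>\<^sub>m N"
      using assoc[OF X T X] M by (simp add: XTX simps times_smult_one M_def N_def del: One_nat_def)
    moreover have "M * ?\<kappa> = ?\<kappa> * J ?X ?XT"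
      using nat[OF X X XT TX id_X spin_K_hom] by (simp add: kronecker_one_dim M_def del: One_nat_def)
    moreover have "J ?TX ?X * ?\<kappa> = ?\<kappa> * N"
      using nat[OF XT TX X X spin_K_hom id_X] by (simp add: kronecker_one_dim N_def del: One_nat_def)
    ultimately have eqs: "a * J ?X ?XT $$ (0, 0) = d * J ?I ?T $$ (0, 0)"
      "d * J ?T ?I $$ (0, 0) = b * J ?TX ?X $$ (0, 0)"
      "b * M $$ (0, 0) = a * N $$ (0, 0)"
      "(M * ?\<kappa>) $$ (0, 0) = (?\<kappa> * J ?X ?XT) $$ (0, 0)"
      "(J ?TX ?X * ?\<kappa>) $$ (0, 0) = (?\<kappa> * N) $$ (0, 0)"
      using M I2 by (metis carrier_matD index_smult_mat(1) pos2)+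
    \<comment> \<open>\<open>?\<kappa>\<close> is diagonal with corner entry \<i>, so comparing
      corner entries cancels it.\<close>
    have "M $$ (0, 0) = J ?X ?XT $$ (0, 0)" "J ?TX ?X $$ (0, 0) = N $$ (0, 0)"
      using eqs(4,5) mat2_times_index[OF _ kappa] mat2_times_index[OF kappa] M
      by (simp_all add: mat_of_mat2_index spin_K_def del: One_nat_def index_mult_mat)
    moreover have "p * J ?I ?T $$ (0, 0) = 1" "p * J ?T ?I $$ (0, 0) = 1"
      using arg_cong[OF unit_left[OF T], of "\<lambda>M. M $$ (0, 0)"]
        arg_cong[OF unit_right[OF T], of "\<lambda>M. M $$ (0, 0)"] I2 by auto
    ultimately have M_N: "a * (p * M $$ (0, 0)) = d" "b * (p * N $$ (0, 0)) = d"
      "b * M $$ (0, 0) = a * N $$ (0, 0)"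
      using eqs(1,2,3) by (metis mult.left_commute mult.right_neutral)+
    \<comment> \<open>\<open>d\<close> is written first through \<open>M\<close> and at the end
      through \<open>N\<close>; the XTX relation passes from one to the other.\<close>
    have "b * b * d = a * b * p * (b * M $$ (0, 0))" by (simp add: mult_ac flip: M_N(1))
    also have "\<dots> = a * a * d" unfolding M_N(3) by (simp add: mult_ac flip: M_N(2))
    finally show ?thesis using \<open>d \<noteq> 0\<close> by simp
  qed

  define G where "G = J ?X ?TT"
  define H where "H = J ?TT ?X"
  define N where "N = J ?T ?T"
  define P where "P = J ?XT ?T"
  define P' where "P' = J ?T ?XT"
  define R where "R = J ?TX ?T"
  define R' where "R' = J ?T ?TX"
  define L where "L = kronecker ?\<kappa> (1\<^sub>m 2)"
  define L' where "L' = kronecker (1\<^sub>m 2) ?\<kappa>"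
  note defs = G_def H_def N_def P_def P'_def R_def R'_def L_def L'_def
  have s: "singlet \<in> carrier_mat 4 1" by (simp add: singlet_def)
  have C: "G \<in> carrier_mat 4 4" "H \<in> carrier_mat 4 4" "N \<in> carrier_mat 4 4"
    "P \<in> carrier_mat 4 4" "P' \<in> carrier_mat 4 4" "R \<in> carrier_mat 4 4" "R' \<in> carrier_mat 4 4"
    using car[OF X TT] car[OF TT X] car[OF T T] car[OF XT T] car[OF T XT] car[OF TX T] car[OF T TX]
    by (simp_all add: defs)
  have L: "L \<in> carrier_mat 4 4" "L' \<in> carrier_mat 4 4"
    using kronecker_carrier[OF kappa one_carrier_mat[of 2]]
      kronecker_carrier[OF one_carrier_mat[of 2] kappa] by (simp_all add: defs)
  note times_one = times_smult_one[OF C(1)] times_smult_one[OF C(2)] times_smult_one[OF C(3)]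
    times_smult_one[OF C(4)] times_smult_one[OF C(5)] times_smult_one[OF C(6)] times_smult_one[OF C(7)]
  \<comment> \<open>All relations below are evaluated at \<open>singlet\<close> and reduced to
    multiples of this one nonzero vector.\<close>
  define y where "y = N * singlet"
  have y: "y \<in> carrier_mat 4 1" using C(3) s by (simp add: y_def)

  \<comment> \<open>Associativity on XTT, TTX and TXT; the minus sign in the third is the action of
    \<open>\<Phi>\<close> on TXT.\<close>
  have "G * N = a \<cdot>\<^sub>m P"
    using assoc[OF X T T] C times_one by (simp add: XTT simps defs del: One_nat_def)
  have "b \<cdot>\<^sub>m R' = H * N"
    using assoc[OF T T X] C times_one by (simp add: TTX simps defs del: One_nat_def)
  have "(- a) \<cdot>\<^sub>m P' = b \<cdot>\<^sub>m R"
    using assoc[OF T X T] C times_one times_smult_one[of "(- 1) \<cdot>\<^sub>m P'" 4 4 a]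
    by (simp add: TXT simps defs mult_smult_assoc_mat[of _ 4 4] smult_smult_mat del: One_nat_def)
  have "R * L = L * P"
    using nat[OF XT TX T T spin_K_hom id_T] by (simp add: defs)
  have "R' * L' = L' * P'"
    using nat[OF T T XT TX id_T spin_K_hom] by (simp add: defs)
  have N_hom: "N \<in> module_hom ?TT ?TT" using hom[OF T T] by (simp add: N_def)
  \<comment> \<open>\<open>N\<close> is itself an endomorphism of \<open>?TT\<close>, so naturality
    of \<open>J\<close> applies to it.\<close>
  have "G * N = N * G"
    using nat[OF X X TT TT id_X N_hom] by (simp add: G_def kronecker_one_dim del: One_nat_def)
  have "H * N = N * H"
    using nat[OF TT TT X X N_hom id_X] by (simp add: H_def kronecker_one_dim del: One_nat_def)
  \<comment> \<open>Naturality along \<open>singlet\<close> moves \<open>G\<close> to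
    \<open>J ?X ?I\<close>, which the unit axiom determines.\<close>
  have Gs: "p \<cdot>\<^sub>m (G * singlet) = singlet"
  proof -
    have XI: "J ?X ?I \<in> carrier_mat 1 1" using car[OF X I] by simp
    have "G * singlet = singlet * J ?X ?I"
      using nat[OF X X I TT id_X singlet_hom] by (simp add: G_def kronecker_one_dim del: One_nat_def)
    then have "p \<cdot>\<^sub>m (G * singlet) = singlet * (p \<cdot>\<^sub>m J ?X ?I)"
      by (simp add: mult_smult_distrib[OF s XI])
    then show ?thesis using unit_right[OF X] right_mult_one_mat[OF s] by simp
  qed
  have Hs: "p \<cdot>\<^sub>m (H * singlet) = singlet"
  proof -
    have IX: "J ?I ?X \<in> carrier_mat 1 1" using car[OF I X] by simp
    have "H * singlet = singlet * J ?I ?X"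
      using nat[OF I TT X X singlet_hom id_X] by (simp add: H_def kronecker_one_dim del: One_nat_def)
    then have "p \<cdot>\<^sub>m (H * singlet) = singlet * (p \<cdot>\<^sub>m J ?I ?X)"
      by (simp add: mult_smult_distrib[OF s IX])
    then show ?thesis using unit_left[OF X] right_mult_one_mat[OF s] by simp
  qed
  \<comment> \<open>K is grouplike, so applying \<open>?\<kappa>\<close> in both factors is the
    action of K on \<open>?TT\<close>. It fixes \<open>singlet\<close>, and hence
    \<open>y\<close>.\<close>
  have LL: "L' * L = act ?TT qK"
    unfolding L_def L'_def kronecker_mult[OF one_carrier_mat kappa kappa one_carrier_mat]
    by (simp add: act_module_tensor[OF T T] act_spin spin_rep_simps left_mult_one_mat[OF kappa]
        right_mult_one_mat[OF kappa])
  have K: "act ?TT qK \<in> carrier_mat 4 4"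
    using mult_carrier_mat[OF L(2,1)] by (simp add: LL)
  have Ks: "act ?TT qK * singlet = singlet"
  proof -
    have "act ?I qK = 1\<^sub>m 1" by (auto simp: unit_module_def counit_simps)
    moreover have "singlet * act ?I qK = act ?TT qK * singlet"
      using singlet_hom by (simp add: module_hom_def)
    ultimately show ?thesis using right_mult_one_mat[OF s] by simp
  qed
  have Ky: "act ?TT qK * y = y"
    unfolding y_def assoc_mult_mat[OF K C(3) s, symmetric]
    using comm[OF T T, of qK, folded N_def, symmetric]
    by (simp add: assoc_mult_mat[OF C(3) K s] Ks)
  have y0: "y \<noteq> 0\<^sub>m 4 1"
  proof
    assume "y = 0\<^sub>m 4 1"
    obtain B where B: "B \<in> carrier_mat 4 4" "B * N = 1\<^sub>m 4"
      using invertible_matE[OF inv[OF T T, folded N_def] C(3)] by blast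
    have "singlet = B * N * singlet" using B(2) left_mult_one_mat[OF s] by simp
    also have "\<dots> = 0\<^sub>m 4 1"
      using \<open>y = 0\<^sub>m 4 1\<close> B(1) unfolding y_def by (simp add: assoc_mult_mat[OF B(1) C(3) s])
    finally show False
      by (auto simp: singlet_def dest: arg_cong[where f = "\<lambda>M. M $$ (1, 0)"])
  qed

  have Ps: "(p * a) \<cdot>\<^sub>m (P * singlet) = y"
  proof -
    have "a \<cdot>\<^sub>m (P * singlet) = G * N * singlet"
      unfolding \<open>G * N = a \<cdot>\<^sub>m P\<close> by (rule mult_smult_assoc_mat[OF C(4) s, symmetric])
    also have "\<dots> = N * (G * singlet)"
      unfolding \<open>G * N = N * G\<close> by (rule assoc_mult_mat[OF C(3,1) s])
    finally show ?thesis
      using mult_smult_distrib[OF C(3) mult_carrier_mat[OF C(1) s], of p] Gs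
      by (simp add: y_def flip: smult_smult_mat)
  qed
  have R's: "(p * b) \<cdot>\<^sub>m (R' * singlet) = y"
  proof -
    have "b \<cdot>\<^sub>m (R' * singlet) = H * N * singlet"
      unfolding \<open>b \<cdot>\<^sub>m R' = H * N\<close>[symmetric]
      by (rule mult_smult_assoc_mat[OF C(7) s, symmetric])
    also have "\<dots> = N * (H * singlet)"
      unfolding \<open>H * N = N * H\<close> by (rule assoc_mult_mat[OF C(3,2) s])
    finally show ?thesis
      using mult_smult_distrib[OF C(3) mult_carrier_mat[OF C(2) s], of p] Hs
      by (simp add: y_def flip: smult_smult_mat)
  qed
  \<comment> \<open>Naturality turns \<open>R * L\<close> into \<open>L * P\<close>; then
    \<open>L' * L\<close> is the action of K, which fixes the vector \<open>y\<close> given by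
    \<open>Ps\<close>.\<close>
  have RL: "(p * a) \<cdot>\<^sub>m (L' * (R * (L * singlet))) = y"
  proof -
    have "R * (L * singlet) = L * (P * singlet)"
      using \<open>R * L = L * P\<close> by (simp flip: assoc_mult_mat[OF C(6) L(1) s] assoc_mult_mat[OF L(1) C(4) s])
    then have "L' * (R * (L * singlet)) = act ?TT qK * (P * singlet)"
      by (simp add: assoc_mult_mat[OF L(2,1) mult_carrier_mat[OF C(4) s]] flip: LL)
    then have "(p * a) \<cdot>\<^sub>m (L' * (R * (L * singlet))) = act ?TT qK * ((p * a) \<cdot>\<^sub>m (P * singlet))"
      by (simp add: mult_smult_distrib[OF K mult_carrier_mat[OF C(4) s]])
    then show ?thesis by (simp add: Ps Ky)
  qed
  \<comment> \<open>Here \<open>L'\<close> is moved to the right past \<open>P'\<close> instead, so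
    that K acts directly on the invariant vector.\<close>
  have P'L: "(p * b) \<cdot>\<^sub>m (L' * (P' * (L * singlet))) = y"
  proof -
    note Ls = mult_carrier_mat[OF L(1) s]
    have "L' * (P' * (L * singlet)) = R' * (L' * (L * singlet))"
      using \<open>R' * L' = L' * P'\<close>
      by (simp flip: assoc_mult_mat[OF L(2) C(5) Ls] assoc_mult_mat[OF C(7) L(2) Ls])
    also have "L' * (L * singlet) = singlet"
      by (simp add: LL Ks flip: assoc_mult_mat[OF L(2,1) s])
    finally show ?thesis by (simp add: R's)
  qed
  \<comment> \<open>The TXT relation is placed between \<open>L'\<close> and
    \<open>L * singlet\<close>, so that \<open>P'L\<close> and \<open>RL\<close> evaluate its two
    sides.\<close>
  have "(- a) \<cdot>\<^sub>m (L' * (P' * (L * singlet))) = b \<cdot>\<^sub>m (L' * (R * (L * singlet)))"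
  proof -
    note Ls = mult_carrier_mat[OF L(1) s]
    show ?thesis
      using arg_cong[OF \<open>(- a) \<cdot>\<^sub>m P' = b \<cdot>\<^sub>m R\<close>, of "\<lambda>M. L' * (M * (L * singlet))"]
      unfolding mult_smult_assoc_mat[OF C(5) Ls] mult_smult_assoc_mat[OF C(6) Ls]
        mult_smult_distrib[OF L(2) mult_carrier_mat[OF C(5) Ls]]
        mult_smult_distrib[OF L(2) mult_carrier_mat[OF C(6) Ls]] .
  qed
  \<comment> \<open>The factor \<open>p * a * b\<close> supplies the normalisation
    \<open>p * b\<close> on the left and \<open>p * a\<close> on the right.\<close>
  then have "(p * a * b * (- a)) \<cdot>\<^sub>m (L' * (P' * (L * singlet))) =
      (p * a * b * b) \<cdot>\<^sub>m (L' * (R * (L * singlet)))"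
    by (simp only: flip: smult_smult_mat)
  then have "(- (a * a)) \<cdot>\<^sub>m ((p * b) \<cdot>\<^sub>m (L' * (P' * (L * singlet)))) =
      (b * b) \<cdot>\<^sub>m ((p * a) \<cdot>\<^sub>m (L' * (R * (L * singlet))))"
    by (simp add: smult_smult_mat mult_ac)
  then have yy: "(- (a * a)) \<cdot>\<^sub>m y = (b * b) \<cdot>\<^sub>m y"
    by (simp only: RL P'L)
  obtain i where "i < 4" "y $$ (i, 0) \<noteq> 0"
    using y0 y by (metis carrier_matD eq_matI index_zero_mat less_one)
  moreover have "(- (a * a)) * y $$ (i, 0) = b * b * y $$ (i, 0)"
    using arg_cong[OF yy, of "\<lambda>M. M $$ (i, 0)"] y \<open>i < 4\<close> by simp
  ultimately have "- (a * a) = b * b" using mult_right_cancel by blast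
  \<comment> \<open>The two relations make a^2 equal to its negative. By \<open>Ps\<close>,
    \<open>a = 0\<close> would force \<open>y\<close> to vanish.\<close>
  with \<open>b * b = a * a\<close> have "a = 0" by simp
  then show False
    using Ps y0 s C(4) by (simp add: zero_smult_mat)
qed

theorem corollary1p3:
  fixes \<beta> :: complex
  assumes "\<beta> ^ 4 = - 1"
  shows "\<not> (\<exists>\<F> \<F>' :: (Q, Q) tensor.
            \<F> * \<F>' = 1 \<and> \<F>' * \<F> = 1 \<and>
            counit_id \<F> = 1 \<and> id_counit \<F> = 1 \<and>
            (\<forall>a. \<F> * \<Delta> a = \<Delta> a * \<F>) \<and>
            coassociator \<beta> =
              (\<F> \<otimes>\<^sub>C 1) * coproduct_id \<F> * id_coproduct \<F>' * tensor_assoc (1 \<otimes>\<^sub>C \<F>')) \<and>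
         \<not> (\<exists>J \<phi>. monoidal_identity (coassociator \<beta>) J \<phi>)"
proof -
  have "\<not> monoidal_identity (coassociator \<beta>) J \<phi>" for J \<phi>
    by (rule not_monoidal_identity) (rule act3_coassociator)+
  \<comment> \<open>The action of a twist would be a monoidal structure, so excluding these excludes
    twists as well.\<close>
  then show ?thesis using monoidal_identity_of_twist by metis
qed

end
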